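(* Let $M$ be a proper pointwise slant submanifold of a cosymplectic manifold $(N,\phi,\xi,\eta,g)$. Then the $2$-form $\Omega$ on $M$ defined by $\Omega(X,Y):=g(X,TY)$ for $X,Y\in\Gamma(TM)$ is closed.
   Context: An almost contact metric manifold $(N,\phi,\xi,\eta,g)$ is a smooth manifold $N$ of dimension $2n+1$ with a tensor field $\phi$ of type $(1,1)$, a vector field $\xi$, a $1$-form $\eta$ and a Riemannian metric $g$ such that $\phi^2=-I+\eta\otimes\xi$, $\eta(\xi)=1$ and $g(\phi X,\phi Y)=g(X,Y)-\eta(X)\eta(Y)$ for all vector fields $X,Y$ (hence $\phi\xi=0$, $\eta\circ\phi=0$, $\eta(X)=g(X,\xi)$). It is cosymplectic if and only if $\overline{\nabla}\phi=0$, where $\overline{\nabla}$ is the Levi-Civita connection of $(N,g)$; in that case also $\overline{\nabla}\eta=0$ and $\overline{\nabla}\xi=0$. For a submanifold $M$ of $N$ and $p\in M$ put $M_p:=\{X\in T_pM\mid g(X,\xi(p))=0\}$. $M$ is a pointwise slant submanifold if at each given point $p\in M$ the angle $\theta=\theta(X)$ between $\phi X$ and $M_p$ is constant for nonzero $X\in M_p$; the function $\theta$ on $M$ is the slant function. $M$ is proper if $\theta$ takes values in $[0,\frac{\pi}{2})$. For $X$ tangent to $M$ write $\phi X=TX+FX$, with $TX$ tangent to $M$ and $FX$ normal to $M$. *)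

theory Defs
  imports "HOL-Analysis.Analysis"
begin

section \<open>Smooth maps between finite-dimensional vector spaces\<close>

text \<open>
  \<open>Ck_on k S f\<close> says that all iterated directional derivatives of \<open>f\<close> up to order \<open>k\<close> exist
  (as Frechet derivatives) and are continuous on the open set \<open>S\<close>. On a finite-dimensional domain,
  the only case used below, this is the usual notion of class \<open>C\<^sup>k\<close>.
\<close>

primrec Ck_on :: "nat \<Rightarrow> 'v::real_normed_vector set \<Rightarrow> ('v \<Rightarrow> 'w::real_normed_vector) \<Rightarrow> bool" where
  "Ck_on 0 S f \<longleftrightarrow> continuous_on S f"
| "Ck_on (Suc k) S f \<longleftrightarrow>
     (\<forall>x\<in>S. f differentiable (at x)) \<and>
     (\<forall>v. Ck_on k S (\<lambda>x. frechet_derivative f (at x) v))"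

definition smooth_on :: "'v::real_normed_vector set \<Rightarrow> ('v \<Rightarrow> 'w::real_normed_vector) \<Rightarrow> bool" where
  "smooth_on S f \<longleftrightarrow> (\<forall>k. Ck_on k S f)"


section \<open>Smooth manifolds\<close>

text \<open>A chart is a pair of a domain and a map, of which only the values on the domain matter.\<close>

type_synonym ('a, 'e) chart = "'a set \<times> ('a \<Rightarrow> 'e)"

record ('a, 'e) manifold =
  mtop :: "'a topology"
  atlas :: "('a, 'e) chart set"

definition carrier :: "('a, 'e) manifold \<Rightarrow> 'a set" where
  "carrier M = topspace (mtop M)"

definition charts_at :: "('a, 'e) manifold \<Rightarrow> 'a \<Rightarrow> ('a, 'e) chart set" where
  "charts_at M p = {c \<in> atlas M. p \<in> fst c}"

definition chart_inv :: "('a, 'e) chart \<Rightarrow> 'e \<Rightarrow> 'a" where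
  "chart_inv c = inv_into (fst c) (snd c)"

definition local_rep :: "('a, 'e) chart \<Rightarrow> ('b, 'f) chart \<Rightarrow> ('a \<Rightarrow> 'b) \<Rightarrow> 'e \<Rightarrow> 'f" where
  "local_rep c d f = snd d \<circ> f \<circ> chart_inv c"

definition transition :: "('a, 'e) chart \<Rightarrow> ('a, 'e) chart \<Rightarrow> 'e \<Rightarrow> 'e" where
  "transition c d = local_rep c d (\<lambda>p. p)"

text \<open>
  The model space is of class \<open>real_normed_vector\<close>, with finite dimension required explicitly,
  because the class \<open>euclidean_space\<close> has no zero-dimensional member. The atlas need
  not be maximal: none of the notions below changes when compatible charts are added.
\<close>

definition smooth_manifold :: "nat \<Rightarrow> ('a, 'e::real_normed_vector) manifold \<Rightarrow> bool" where
  "smooth_manifold m M \<longleftrightarrow>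
     (\<exists>B::'e set. finite B \<and> independent B \<and> span B = UNIV \<and> card B = m) \<and>
     Hausdorff_space (mtop M) \<and> second_countable (mtop M) \<and>
     (\<Union>c\<in>atlas M. fst c) = carrier M \<and>
     (\<forall>c\<in>atlas M. openin (mtop M) (fst c) \<and> open (snd c ` fst c) \<and>
        homeomorphic_map (subtopology (mtop M) (fst c)) (top_of_set (snd c ` fst c)) (snd c)) \<and>
     (\<forall>c\<in>atlas M. \<forall>d\<in>atlas M. smooth_on (snd c ` (fst c \<inter> fst d)) (transition c d))"

definition smooth_function ::
    "('a, 'e::real_normed_vector) manifold \<Rightarrow> ('a \<Rightarrow> real) \<Rightarrow> bool" where
  "smooth_function M f \<longleftrightarrow> (\<forall>c\<in>atlas M. smooth_on (snd c ` fst c) (\<lambda>x. f (chart_inv c x)))"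

definition smooth_map ::
    "('a, 'e::real_normed_vector) manifold \<Rightarrow> ('b, 'f::real_normed_vector) manifold \<Rightarrow>
     ('a \<Rightarrow> 'b) \<Rightarrow> bool" where
  "smooth_map M N f \<longleftrightarrow> continuous_map (mtop M) (mtop N) f \<and>
     (\<forall>c\<in>atlas M. \<forall>d\<in>atlas N. smooth_on (snd c ` {p \<in> fst c. f p \<in> fst d}) (local_rep c d f))"


section \<open>Tangent vectors\<close>

text \<open>
  A tangent vector at \<open>p\<close> is the family of its components with respect to all charts around \<open>p\<close>,
  related by the derivatives of the transition maps. The entries at all other charts are \<open>0\<close>, so
  that the families form a vector space isomorphic to the model space.
\<close>

typedef ('a, 'e) tvec = "UNIV :: (('a, 'e) chart \<Rightarrow> 'e) set"
  morphisms component Tvec by simp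

instantiation tvec :: (type, real_vector) real_vector
begin

definition zero_tvec :: "('a, 'b) tvec" where
  "0 = Tvec (\<lambda>c. 0)"

definition plus_tvec :: "('a, 'b) tvec \<Rightarrow> ('a, 'b) tvec \<Rightarrow> ('a, 'b) tvec" where
  "u + v = Tvec (\<lambda>c. component u c + component v c)"

definition minus_tvec :: "('a, 'b) tvec \<Rightarrow> ('a, 'b) tvec \<Rightarrow> ('a, 'b) tvec" where
  "u - v = Tvec (\<lambda>c. component u c - component v c)"

definition uminus_tvec :: "('a, 'b) tvec \<Rightarrow> ('a, 'b) tvec" where
  "- u = Tvec (\<lambda>c. - component u c)"

definition scaleR_tvec :: "real \<Rightarrow> ('a, 'b) tvec \<Rightarrow> ('a, 'b) tvec" where
  "r *\<^sub>R u = Tvec (\<lambda>c. r *\<^sub>R component u c)"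

instance
  by standard
    (simp_all add: zero_tvec_def plus_tvec_def minus_tvec_def uminus_tvec_def scaleR_tvec_def
       Tvec_inverse component_inverse algebra_simps)

end

definition tangent_space :: "('a, 'e::real_normed_vector) manifold \<Rightarrow> 'a \<Rightarrow> ('a, 'e) tvec set" where
  "tangent_space M p = {v.
     (\<forall>c\<in>charts_at M p. \<forall>d\<in>charts_at M p.
        component v d = frechet_derivative (transition c d) (at (snd c p)) (component v c)) \<and>
     (\<forall>c. c \<notin> charts_at M p \<longrightarrow> component v c = 0)}"

definition dir_deriv ::
    "('a, 'e::real_normed_vector) manifold \<Rightarrow> 'a \<Rightarrow> ('a, 'e) tvec \<Rightarrow> ('a \<Rightarrow> real) \<Rightarrow> real" where
  "dir_deriv M p v f =
     (let c = (SOME c. c \<in> charts_at M p)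
      in frechet_derivative (\<lambda>x. f (chart_inv c x)) (at (snd c p)) (component v c))"

definition differential ::
    "('a, 'e::real_normed_vector) manifold \<Rightarrow> ('b, 'f::real_normed_vector) manifold \<Rightarrow>
     ('a \<Rightarrow> 'b) \<Rightarrow> 'a \<Rightarrow> ('a, 'e) tvec \<Rightarrow> ('b, 'f) tvec" where
  "differential M N f p v =
     (let c = (SOME c. c \<in> charts_at M p)
      in Tvec (\<lambda>d. if d \<in> charts_at N (f p)
                   then frechet_derivative (local_rep c d f) (at (snd c p)) (component v c)
                   else 0))"

text \<open>The tangent vector at \<open>p\<close> whose component in the chart \<open>c\<close> is \<open>u\<close>.\<close>

definition coord_field ::
    "('a, 'e::real_normed_vector) manifold \<Rightarrow> ('a, 'e) chart \<Rightarrow> 'e \<Rightarrow> 'a \<Rightarrow> ('a, 'e) tvec" where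
  "coord_field M c u p =
     Tvec (\<lambda>d. if d \<in> charts_at M p
               then frechet_derivative (transition c d) (at (snd c p)) u else 0)"


section \<open>Vector fields and tensor fields\<close>

text \<open>
  Vector fields and fields of endomorphisms are taken to vanish outside the carrier, so that
  fields that agree on the manifold are equal as functions.
\<close>

definition vector_field ::
    "('a, 'e::real_normed_vector) manifold \<Rightarrow> ('a \<Rightarrow> ('a, 'e) tvec) \<Rightarrow> bool" where
  "vector_field M X \<longleftrightarrow>
     (\<forall>p\<in>carrier M. X p \<in> tangent_space M p) \<and> (\<forall>p. p \<notin> carrier M \<longrightarrow> X p = 0) \<and>
     (\<forall>c\<in>atlas M. smooth_on (snd c ` fst c) (\<lambda>x. component (X (chart_inv c x)) c))"

definition lie_bracket ::
    "('a, 'e::real_normed_vector) manifold \<Rightarrow> ('a \<Rightarrow> ('a, 'e) tvec) \<Rightarrow> ('a \<Rightarrow> ('a, 'e) tvec) \<Rightarrow>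
     'a \<Rightarrow> ('a, 'e) tvec" where
  "lie_bracket M X Y p = Tvec (\<lambda>c. if c \<in> charts_at M p
     then frechet_derivative (\<lambda>x. component (Y (chart_inv c x)) c) (at (snd c p)) (component (X p) c)
        - frechet_derivative (\<lambda>x. component (X (chart_inv c x)) c) (at (snd c p)) (component (Y p) c)
     else 0)"

definition lin_on :: "'v::real_vector set \<Rightarrow> ('v \<Rightarrow> 'w::real_vector) \<Rightarrow> bool" where
  "lin_on V f \<longleftrightarrow> (\<forall>u\<in>V. \<forall>v\<in>V. \<forall>a b. f (a *\<^sub>R u + b *\<^sub>R v) = a *\<^sub>R f u + b *\<^sub>R f v)"

definition one_form ::
    "('a, 'e::real_normed_vector) manifold \<Rightarrow> ('a \<Rightarrow> ('a, 'e) tvec \<Rightarrow> real) \<Rightarrow> bool" where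
  "one_form M \<alpha> \<longleftrightarrow>
     (\<forall>p\<in>carrier M. lin_on (tangent_space M p) (\<alpha> p)) \<and>
     (\<forall>c\<in>atlas M. \<forall>u. smooth_on (snd c ` fst c)
        (\<lambda>x. \<alpha> (chart_inv c x) (coord_field M c u (chart_inv c x))))"

text \<open>Tensor fields of type (1,1) and (0,2).\<close>

definition endo_field ::
    "('a, 'e::real_normed_vector) manifold \<Rightarrow> ('a \<Rightarrow> ('a, 'e) tvec \<Rightarrow> ('a, 'e) tvec) \<Rightarrow> bool" where
  "endo_field M A \<longleftrightarrow>
     (\<forall>p\<in>carrier M. lin_on (tangent_space M p) (A p) \<and>
        A p ` tangent_space M p \<subseteq> tangent_space M p) \<and>
     (\<forall>p v. p \<notin> carrier M \<longrightarrow> A p v = 0) \<and>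
     (\<forall>c\<in>atlas M. \<forall>u. smooth_on (snd c ` fst c)
        (\<lambda>x. component (A (chart_inv c x) (coord_field M c u (chart_inv c x))) c))"

definition bilinear_field ::
    "('a, 'e::real_normed_vector) manifold \<Rightarrow> ('a \<Rightarrow> ('a, 'e) tvec \<Rightarrow> ('a, 'e) tvec \<Rightarrow> real) \<Rightarrow> bool"
  where
  "bilinear_field M h \<longleftrightarrow>
     (\<forall>p\<in>carrier M. \<forall>u\<in>tangent_space M p.
        lin_on (tangent_space M p) (\<lambda>v. h p u v) \<and> lin_on (tangent_space M p) (\<lambda>v. h p v u)) \<and>
     (\<forall>c\<in>atlas M. \<forall>u v. smooth_on (snd c ` fst c)
        (\<lambda>x. h (chart_inv c x) (coord_field M c u (chart_inv c x))
                               (coord_field M c v (chart_inv c x))))"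

definition riemannian_metric ::
    "('a, 'e::real_normed_vector) manifold \<Rightarrow> ('a \<Rightarrow> ('a, 'e) tvec \<Rightarrow> ('a, 'e) tvec \<Rightarrow> real) \<Rightarrow> bool"
  where
  "riemannian_metric M g \<longleftrightarrow> bilinear_field M g \<and>
     (\<forall>p\<in>carrier M. \<forall>u\<in>tangent_space M p. \<forall>v\<in>tangent_space M p. g p u v = g p v u) \<and>
     (\<forall>p\<in>carrier M. \<forall>u\<in>tangent_space M p. u \<noteq> 0 \<longrightarrow> g p u u > 0)"

definition two_form ::
    "('a, 'e::real_normed_vector) manifold \<Rightarrow> ('a \<Rightarrow> ('a, 'e) tvec \<Rightarrow> ('a, 'e) tvec \<Rightarrow> real) \<Rightarrow> bool"
  where
  "two_form M \<omega> \<longleftrightarrow> bilinear_field M \<omega> \<and>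
     (\<forall>p\<in>carrier M. \<forall>u\<in>tangent_space M p. \<omega> p u u = 0)"

text \<open>
  The invariant formula for the exterior derivative. Some authors include a factor \<open>1/3\<close>, which
  makes no difference for closedness.
\<close>

definition ext_deriv ::
    "('a, 'e::real_normed_vector) manifold \<Rightarrow> ('a \<Rightarrow> ('a, 'e) tvec \<Rightarrow> ('a, 'e) tvec \<Rightarrow> real) \<Rightarrow>
     ('a \<Rightarrow> ('a, 'e) tvec) \<Rightarrow> ('a \<Rightarrow> ('a, 'e) tvec) \<Rightarrow> ('a \<Rightarrow> ('a, 'e) tvec) \<Rightarrow> 'a \<Rightarrow> real" where
  "ext_deriv M \<omega> X Y Z p =
     dir_deriv M p (X p) (\<lambda>q. \<omega> q (Y q) (Z q))
   - dir_deriv M p (Y p) (\<lambda>q. \<omega> q (X q) (Z q))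
   + dir_deriv M p (Z p) (\<lambda>q. \<omega> q (X q) (Y q))
   - \<omega> p (lie_bracket M X Y p) (Z p)
   + \<omega> p (lie_bracket M X Z p) (Y p)
   - \<omega> p (lie_bracket M Y Z p) (X p)"

definition closed_form ::
    "('a, 'e::real_normed_vector) manifold \<Rightarrow> ('a \<Rightarrow> ('a, 'e) tvec \<Rightarrow> ('a, 'e) tvec \<Rightarrow> real) \<Rightarrow> bool"
  where
  "closed_form M \<omega> \<longleftrightarrow> (\<forall>X Y Z. vector_field M X \<longrightarrow> vector_field M Y \<longrightarrow> vector_field M Z \<longrightarrow>
     (\<forall>p\<in>carrier M. ext_deriv M \<omega> X Y Z p = 0))"


section \<open>Connections\<close>

definition affine_connection ::
    "('a, 'e::real_normed_vector) manifold \<Rightarrow>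
     (('a \<Rightarrow> ('a, 'e) tvec) \<Rightarrow> ('a \<Rightarrow> ('a, 'e) tvec) \<Rightarrow> 'a \<Rightarrow> ('a, 'e) tvec) \<Rightarrow> bool" where
  "affine_connection M D \<longleftrightarrow>
     (\<forall>X Y. vector_field M X \<longrightarrow> vector_field M Y \<longrightarrow> vector_field M (D X Y)) \<and>
     (\<forall>f h X X' Y. smooth_function M f \<longrightarrow> smooth_function M h \<longrightarrow>
        vector_field M X \<longrightarrow> vector_field M X' \<longrightarrow> vector_field M Y \<longrightarrow>
        (\<forall>p\<in>carrier M. D (\<lambda>q. f q *\<^sub>R X q + h q *\<^sub>R X' q) Y p = f p *\<^sub>R D X Y p + h p *\<^sub>R D X' Y p)) \<and>
     (\<forall>X Y Y'. vector_field M X \<longrightarrow> vector_field M Y \<longrightarrow> vector_field M Y' \<longrightarrow>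
        (\<forall>p\<in>carrier M. D X (\<lambda>q. Y q + Y' q) p = D X Y p + D X Y' p)) \<and>
     (\<forall>f X Y. smooth_function M f \<longrightarrow> vector_field M X \<longrightarrow> vector_field M Y \<longrightarrow>
        (\<forall>p\<in>carrier M. D X (\<lambda>q. f q *\<^sub>R Y q) p = dir_deriv M p (X p) f *\<^sub>R Y p + f p *\<^sub>R D X Y p))"

definition levi_civita ::
    "('a, 'e::real_normed_vector) manifold \<Rightarrow> ('a \<Rightarrow> ('a, 'e) tvec \<Rightarrow> ('a, 'e) tvec \<Rightarrow> real) \<Rightarrow>
     (('a \<Rightarrow> ('a, 'e) tvec) \<Rightarrow> ('a \<Rightarrow> ('a, 'e) tvec) \<Rightarrow> 'a \<Rightarrow> ('a, 'e) tvec) \<Rightarrow> bool" where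
  "levi_civita M g D \<longleftrightarrow> affine_connection M D \<and>
     (\<forall>X Y. vector_field M X \<longrightarrow> vector_field M Y \<longrightarrow>
        (\<forall>p\<in>carrier M. D X Y p - D Y X p = lie_bracket M X Y p)) \<and>
     (\<forall>X Y Z. vector_field M X \<longrightarrow> vector_field M Y \<longrightarrow> vector_field M Z \<longrightarrow>
        (\<forall>p\<in>carrier M. dir_deriv M p (X p) (\<lambda>q. g q (Y q) (Z q))
                         = g p (D X Y p) (Z p) + g p (Y p) (D X Z p)))"

text \<open>\<open>(\<nabla>\<^sub>X A) Y = \<nabla>\<^sub>X (A Y) - A (\<nabla>\<^sub>X Y)\<close>\<close>

definition cov_deriv_endo ::
    "(('a \<Rightarrow> ('a, 'e::real_normed_vector) tvec) \<Rightarrow> ('a \<Rightarrow> ('a, 'e) tvec) \<Rightarrow> 'a \<Rightarrow> ('a, 'e) tvec) \<Rightarrow>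
     ('a \<Rightarrow> ('a, 'e) tvec \<Rightarrow> ('a, 'e) tvec) \<Rightarrow>
     ('a \<Rightarrow> ('a, 'e) tvec) \<Rightarrow> ('a \<Rightarrow> ('a, 'e) tvec) \<Rightarrow> 'a \<Rightarrow> ('a, 'e) tvec" where
  "cov_deriv_endo D A X Y p = D X (\<lambda>q. A q (Y q)) p - A p (D X Y p)"


section \<open>Cosymplectic manifolds\<close>

definition almost_contact_metric ::
    "nat \<Rightarrow> ('a, 'e::real_normed_vector) manifold \<Rightarrow> ('a \<Rightarrow> ('a, 'e) tvec \<Rightarrow> ('a, 'e) tvec) \<Rightarrow>
     ('a \<Rightarrow> ('a, 'e) tvec) \<Rightarrow> ('a \<Rightarrow> ('a, 'e) tvec \<Rightarrow> real) \<Rightarrow>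
     ('a \<Rightarrow> ('a, 'e) tvec \<Rightarrow> ('a, 'e) tvec \<Rightarrow> real) \<Rightarrow> bool" where
  "almost_contact_metric n N \<phi> \<xi> \<eta> g \<longleftrightarrow>
     smooth_manifold (2 * n + 1) N \<and> endo_field N \<phi> \<and> vector_field N \<xi> \<and> one_form N \<eta> \<and>
     riemannian_metric N g \<and>
     (\<forall>p\<in>carrier N.
        (\<forall>u\<in>tangent_space N p. \<phi> p (\<phi> p u) = - u + \<eta> p u *\<^sub>R \<xi> p) \<and>
        \<eta> p (\<xi> p) = 1 \<and>
        (\<forall>u\<in>tangent_space N p. \<forall>v\<in>tangent_space N p.
           g p (\<phi> p u) (\<phi> p v) = g p u v - \<eta> p u * \<eta> p v))"

text \<open>The connection is existentially quantified; it is unique by the fundamental theorem of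
  Riemannian geometry.\<close>

definition cosymplectic ::
    "nat \<Rightarrow> ('a, 'e::real_normed_vector) manifold \<Rightarrow> ('a \<Rightarrow> ('a, 'e) tvec \<Rightarrow> ('a, 'e) tvec) \<Rightarrow>
     ('a \<Rightarrow> ('a, 'e) tvec) \<Rightarrow> ('a \<Rightarrow> ('a, 'e) tvec \<Rightarrow> real) \<Rightarrow>
     ('a \<Rightarrow> ('a, 'e) tvec \<Rightarrow> ('a, 'e) tvec \<Rightarrow> real) \<Rightarrow> bool" where
  "cosymplectic n N \<phi> \<xi> \<eta> g \<longleftrightarrow> almost_contact_metric n N \<phi> \<xi> \<eta> g \<and>
     (\<exists>D. levi_civita N g D \<and>
        (\<forall>X Y. vector_field N X \<longrightarrow> vector_field N Y \<longrightarrow>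
           (\<forall>p\<in>carrier N. cov_deriv_endo D \<phi> X Y p = 0)))"


section \<open>Pointwise slant submanifolds\<close>

text \<open>
  A submanifold is a subset with a smooth structure of its own for which the inclusion is an
  immersion; its topology may be finer than the subspace topology, and embedded submanifolds are
  a special case.
\<close>

definition submanifold ::
    "('a, 'f::real_normed_vector) manifold \<Rightarrow> ('a, 'e::real_normed_vector) manifold \<Rightarrow> bool" where
  "submanifold M N \<longleftrightarrow> (\<exists>m. smooth_manifold m M) \<and> carrier M \<subseteq> carrier N \<and>
     smooth_map M N (\<lambda>p. p) \<and>
     (\<forall>p\<in>carrier M. inj_on (differential M N (\<lambda>p. p) p) (tangent_space M p))"

text \<open>The tangent space of a submanifold as a subspace of the tangent space of the ambient
  manifold, and its orthogonal complement.\<close>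

definition sub_tangent ::
    "('a, 'f::real_normed_vector) manifold \<Rightarrow> ('a, 'e::real_normed_vector) manifold \<Rightarrow> 'a \<Rightarrow>
     ('a, 'e) tvec set" where
  "sub_tangent M N p = differential M N (\<lambda>p. p) p ` tangent_space M p"

definition sub_normal ::
    "('a, 'f::real_normed_vector) manifold \<Rightarrow> ('a, 'e::real_normed_vector) manifold \<Rightarrow>
     ('a \<Rightarrow> ('a, 'e) tvec \<Rightarrow> ('a, 'e) tvec \<Rightarrow> real) \<Rightarrow> 'a \<Rightarrow> ('a, 'e) tvec set" where
  "sub_normal M N g p = {v \<in> tangent_space N p. \<forall>w\<in>sub_tangent M N p. g p v w = 0}"

text \<open>The space \<open>M\<^sub>p\<close>.\<close>

definition contact_part ::
    "('a, 'f::real_normed_vector) manifold \<Rightarrow> ('a, 'e::real_normed_vector) manifold \<Rightarrow>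
     ('a \<Rightarrow> ('a, 'e) tvec) \<Rightarrow> ('a \<Rightarrow> ('a, 'e) tvec \<Rightarrow> ('a, 'e) tvec \<Rightarrow> real) \<Rightarrow> 'a \<Rightarrow>
     ('a, 'e) tvec set" where
  "contact_part M N \<xi> g p = {v \<in> sub_tangent M N p. g p v (\<xi> p) = 0}"

definition angle :: "('v \<Rightarrow> 'v \<Rightarrow> real) \<Rightarrow> 'v \<Rightarrow> 'v \<Rightarrow> real" where
  "angle h u v = arccos (h u v / (sqrt (h u u) * sqrt (h v v)))"

text \<open>The angle between a vector and a subspace is the least angle to a nonzero element of
  the subspace.\<close>

definition angle_subspace :: "('v \<Rightarrow> 'v \<Rightarrow> real) \<Rightarrow> 'v \<Rightarrow> 'v::zero set \<Rightarrow> real" where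
  "angle_subspace h u W = (INF w\<in>W - {0}. angle h u w)"

definition slant_function ::
    "('a, 'f::real_normed_vector) manifold \<Rightarrow> ('a, 'e::real_normed_vector) manifold \<Rightarrow>
     ('a \<Rightarrow> ('a, 'e) tvec \<Rightarrow> ('a, 'e) tvec) \<Rightarrow> ('a \<Rightarrow> ('a, 'e) tvec) \<Rightarrow>
     ('a \<Rightarrow> ('a, 'e) tvec \<Rightarrow> ('a, 'e) tvec \<Rightarrow> real) \<Rightarrow> ('a \<Rightarrow> real) \<Rightarrow> bool" where
  "slant_function M N \<phi> \<xi> g \<theta> \<longleftrightarrow>
     (\<forall>p\<in>carrier M. \<forall>v\<in>contact_part M N \<xi> g p. v \<noteq> 0 \<longrightarrow>
        angle_subspace (g p) (\<phi> p v) (contact_part M N \<xi> g p) = \<theta> p)"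

definition proper_pointwise_slant ::
    "('a, 'f::real_normed_vector) manifold \<Rightarrow> ('a, 'e::real_normed_vector) manifold \<Rightarrow>
     ('a \<Rightarrow> ('a, 'e) tvec \<Rightarrow> ('a, 'e) tvec) \<Rightarrow> ('a \<Rightarrow> ('a, 'e) tvec) \<Rightarrow>
     ('a \<Rightarrow> ('a, 'e) tvec \<Rightarrow> ('a, 'e) tvec \<Rightarrow> real) \<Rightarrow> bool" where
  "proper_pointwise_slant M N \<phi> \<xi> g \<longleftrightarrow> submanifold M N \<and>
     (\<exists>\<theta>. slant_function M N \<phi> \<xi> g \<theta> \<and> (\<forall>p\<in>carrier M. 0 \<le> \<theta> p \<and> \<theta> p < pi / 2))"

text \<open>\<open>T X\<close> in the decomposition \<open>\<phi> X = T X + F X\<close>.\<close>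

definition tangential_part ::
    "('a, 'f::real_normed_vector) manifold \<Rightarrow> ('a, 'e::real_normed_vector) manifold \<Rightarrow>
     ('a \<Rightarrow> ('a, 'e) tvec \<Rightarrow> ('a, 'e) tvec) \<Rightarrow>
     ('a \<Rightarrow> ('a, 'e) tvec \<Rightarrow> ('a, 'e) tvec \<Rightarrow> real) \<Rightarrow> 'a \<Rightarrow> ('a, 'e) tvec \<Rightarrow> ('a, 'e) tvec" where
  "tangential_part M N \<phi> g p v =
     (THE t. t \<in> sub_tangent M N p \<and> (\<exists>w\<in>sub_normal M N g p. \<phi> p v = t + w))"

text \<open>\<open>\<Omega>(X, Y) = g(X, T Y)\<close>, where tangent vectors of \<open>M\<close> are identified with their images in
  the tangent space of \<open>N\<close>.\<close>

definition slant_form ::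
    "('a, 'f::real_normed_vector) manifold \<Rightarrow> ('a, 'e::real_normed_vector) manifold \<Rightarrow>
     ('a \<Rightarrow> ('a, 'e) tvec \<Rightarrow> ('a, 'e) tvec) \<Rightarrow>
     ('a \<Rightarrow> ('a, 'e) tvec \<Rightarrow> ('a, 'e) tvec \<Rightarrow> real) \<Rightarrow>
     'a \<Rightarrow> ('a, 'f) tvec \<Rightarrow> ('a, 'f) tvec \<Rightarrow> real" where
  "slant_form M N \<phi> g p u v =
     g p (differential M N (\<lambda>p. p) p u)
         (tangential_part M N \<phi> g p (differential M N (\<lambda>p. p) p v))"

end

theory Submission
  imports Defs
begin

text \<open>
  For tangent vectors \<open>X\<close>, \<open>Y\<close> of \<open>M\<close> the normal component \<open>F Y\<close> does not contribute to
  \<open>g(X, \<phi> Y)\<close>, so \<open>\<Omega>\<close> is the pullback of the two-form \<open>\<Phi>(X, Y) = g(X, \<phi> Y)\<close> on \<open>N\<close>. Because the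
  Levi-Civita connection is metric and torsion-free and \<open>\<nabla>\<phi> = 0\<close>, the terms of \<open>d\<Phi>\<close> cancel in
  pairs, and closedness is preserved by pullback. The computation in \<open>N\<close> uses global vector fields;
  bump functions turn it into an identity between partial derivatives of the components of \<open>\<Phi>\<close> in a
  chart, which is pulled back with the chain rule and the symmetry of second derivatives.
\<close>

section \<open>Calculus of smooth maps\<close>

text \<open>Vector fields on \<open>M\<close> cannot simply be extended to \<open>N\<close>: the
  submanifold is immersed, possibly with a topology finer than the induced one, and an extension
  would still have to be compared with brackets taken in \<open>M\<close>. Hence both exterior
  derivatives are reduced, at a single point, to an expression in the values of the fields there,
  and the comparison takes place between coefficient functions in one chart of \<open>M\<close> and
  one chart of \<open>N\<close>. In \<open>N\<close> only a single vector at a point has to be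
  extended to a global field. A second obstacle is that the model space of \<open>M\<close> is
  merely a finite-dimensional normed space without a distinguished basis. The immersion helps: the
  Jacobian of the inclusion embeds this space in the Euclidean model space of \<open>N\<close>, and
  coordinates are read off there.\<close>

lemma frechet_derivative_eq:
  "(f has_derivative f') (at x) \<Longrightarrow> frechet_derivative f (at x) = f'"
  by (metis frechet_derivative_at)

lemma differentiable_cong_open:
  assumes "open S" "x \<in> S" "\<And>y. y \<in> S \<Longrightarrow> f y = g y" "f differentiable (at x)"
  shows "g differentiable (at x)"
  using assms has_derivative_transform_within_open unfolding differentiable_def by blast

text \<open>Points without a derivative are covered too: \<open>frechet_derivative\<close> chooses
  among the candidates, and functions that agree near \<open>x\<close> have the same
  candidates.\<close>

lemma frechet_derivative_cong_open:
  assumes "open S" "x \<in> S" "\<And>y. y \<in> S \<Longrightarrow> f y = g y"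
  shows "frechet_derivative f (at x) = frechet_derivative g (at x)"
proof -
  have "(f has_derivative D) (at x) \<longleftrightarrow> (g has_derivative D) (at x)" for D
    using assms has_derivative_transform_within_open[of f D x UNIV S g]
      has_derivative_transform_within_open[of g D x UNIV S f] by auto
  then show ?thesis unfolding frechet_derivative_def by simp
qed

section \<open>Closure properties of the classes of k times continuously differentiable maps\<close>

lemma Ck_on_cong:
  assumes "open S" "\<And>x. x \<in> S \<Longrightarrow> f x = g x" "Ck_on k S f"
  shows "Ck_on k S g"
  using assms(2,3)
proof (induction k arbitrary: f g)
  case 0
  then show ?case by (auto cong: continuous_on_cong)
next
  case (Suc k)
  have "frechet_derivative f (at x) v = frechet_derivative g (at x) v" if "x \<in> S" for x v
    using frechet_derivative_cong_open[OF assms(1) that, of f g] Suc.prems(1) by simp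
  then have "Ck_on k S (\<lambda>x. frechet_derivative g (at x) v)" for v
    by (rule Suc.IH[of "\<lambda>x. frechet_derivative f (at x) v"]) (use Suc.prems(2) in auto)
  moreover have "g differentiable (at x)" if "x \<in> S" for x
    by (rule differentiable_cong_open[OF assms(1) that, of f]) (use Suc.prems that in auto)
  ultimately show ?case by simp
qed

lemma Ck_on_SucD: "Ck_on (Suc k) S f \<Longrightarrow> Ck_on k S f"
proof (induction k arbitrary: f)
  case 0
  then show ?case
    by (auto intro!: continuous_at_imp_continuous_on differentiable_imp_continuous_within)
next
  case (Suc k)
  have "Ck_on k S (\<lambda>x. frechet_derivative f (at x) v)" for v
    by (rule Suc.IH) (use Suc.prems in simp)
  with Suc.prems show ?case by simp
qed

lemma Ck_on_local:
  assumes "\<And>x. x \<in> S \<Longrightarrow> \<exists>U. open U \<and> x \<in> U \<and> Ck_on k U f"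
  shows "Ck_on k S f"
  using assms
proof (induction k arbitrary: f)
  case 0
  have "isCont f x" if "x \<in> S" for x
    using 0[OF that] by (auto simp: continuous_on_eq_continuous_at)
  then show ?case by (simp add: continuous_at_imp_continuous_on)
next
  case (Suc k)
  have "f differentiable (at x)" if "x \<in> S" for x
    using Suc.prems[OF that] by auto
  moreover have "Ck_on k S (\<lambda>x. frechet_derivative f (at x) v)" for v
  proof (rule Suc.IH)
    fix x assume "x \<in> S"
    from Suc.prems[OF this]
    show "\<exists>U. open U \<and> x \<in> U \<and> Ck_on k U (\<lambda>x. frechet_derivative f (at x) v)" by auto
  qed
  ultimately show ?case by simp
qed

lemma Ck_on_const: "Ck_on k S (\<lambda>x. c)"
  by (induction k arbitrary: c) auto

lemma Ck_on_bounded_linear: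
  assumes "bounded_linear L"
  shows "Ck_on k S L"
proof (cases k)
  case 0
  then show ?thesis using assms by (simp add: linear_continuous_on)
next
  case (Suc m)
  have d: "(L has_derivative L) (at x)" for x
    using assms by (rule bounded_linear_imp_has_derivative)
  then show ?thesis using Suc
    by (auto simp: frechet_derivative_eq[OF d] Ck_on_const differentiable_def)
qed

lemma Ck_on_add:
  assumes "open S" "Ck_on k S f" "Ck_on k S g"
  shows "Ck_on k S (\<lambda>x. f x + g x)"
  using assms(2,3)
proof (induction k arbitrary: f g)
  case 0
  then show ?case by (simp add: continuous_on_add)
next
  case (Suc k)
  have d: "((\<lambda>x. f x + g x) has_derivative
      (\<lambda>v. frechet_derivative f (at x) v + frechet_derivative g (at x) v)) (at x)" if "x \<in> S" for x
    using that Suc.prems by (auto intro!: has_derivative_add simp flip: frechet_derivative_works)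
  have "Ck_on k S (\<lambda>x. frechet_derivative f (at x) v + frechet_derivative g (at x) v)" for v
    using Suc.prems by (intro Suc.IH) auto
  then have "Ck_on k S (\<lambda>x. frechet_derivative (\<lambda>x. f x + g x) (at x) v)" for v
    by (rule Ck_on_cong[OF assms(1), rotated]) (simp add: frechet_derivative_eq[OF d])
  then show ?case using d by (auto simp: differentiable_def)
qed

lemma Ck_on_sum:
  assumes "open S" "\<And>i. i \<in> I \<Longrightarrow> Ck_on k S (f i)"
  shows "Ck_on k S (\<lambda>x. \<Sum>i\<in>I. f i x)"
  using assms(2)
  by (induction I rule: infinite_finite_induct) (auto simp: Ck_on_const intro!: Ck_on_add[OF assms(1)])

text \<open>The product rule reproduces the same shape: each summand is again \<open>B\<close> of a
  derivative and an undifferentiated factor. The latter is used one order lower, hence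
  \<open>Ck_on_SucD\<close>.\<close>

lemma Ck_on_bilinear:
  assumes "bounded_bilinear B" "open S" "Ck_on k S f" "Ck_on k S g"
  shows "Ck_on k S (\<lambda>x. B (f x) (g x))"
  using assms(3,4)
proof (induction k arbitrary: f g)
  case 0
  then show ?case
    using bounded_bilinear.continuous_on[OF assms(1)] by auto
next
  case (Suc k)
  have d: "((\<lambda>x. B (f x) (g x)) has_derivative
      (\<lambda>v. B (f x) (frechet_derivative g (at x) v) + B (frechet_derivative f (at x) v) (g x))) (at x)"
    if "x \<in> S" for x
    using that Suc.prems
    by (auto intro!: bounded_bilinear.FDERIV[OF assms(1)] simp flip: frechet_derivative_works)
  have "Ck_on k S (\<lambda>x. B (f x) (frechet_derivative g (at x) v) + B (frechet_derivative f (at x) v) (g x))" for v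
    using Suc.prems Suc.prems[THEN Ck_on_SucD] by (intro Ck_on_add[OF assms(2)] Suc.IH) auto
  then have "Ck_on k S (\<lambda>x. frechet_derivative (\<lambda>x. B (f x) (g x)) (at x) v)" for v
    by (rule Ck_on_cong[OF assms(2), rotated]) (simp add: frechet_derivative_eq[OF d])
  then show ?case using d by (auto simp: differentiable_def)
qed

lemma linear_euclidean_sum:
  fixes u :: "'e::euclidean_space"
  assumes "linear L"
  shows "L u = (\<Sum>e\<in>Basis. (u \<bullet> e) *\<^sub>R L e)"
proof -
  have "L (\<Sum>e\<in>Basis. (u \<bullet> e) *\<^sub>R e) = (\<Sum>e\<in>Basis. (u \<bullet> e) *\<^sub>R L e)"
    using assms by (simp add: linear_sum linear_cmul)
  then show ?thesis by (simp add: euclidean_representation)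
qed

text \<open>The chain rule applies the derivative of \<open>f\<close> to a vector that moves with
  \<open>x\<close>, while \<open>Ck_on\<close> controls fixed directions only. Expanding that vector
  in \<open>Basis\<close> leaves products of scalar coefficients with derivatives along fixed basis
  vectors, to which the induction hypothesis applies.\<close>

lemma Ck_on_compose:
  fixes F :: "'u::real_normed_vector \<Rightarrow> 'e::euclidean_space"
  assumes "open S" "open T" "F ` S \<subseteq> T" "Ck_on k T f" "Ck_on k S F"
  shows "Ck_on k S (\<lambda>x. f (F x))"
  using assms(4,5)
proof (induction k arbitrary: f)
  case 0
  then show ?case using assms(3) by (auto intro: continuous_on_compose2)
next
  case (Suc k)
  have fF: "f differentiable (at (F x))" "F differentiable (at x)" if "x \<in> S" for x
    using Suc.prems that assms(3) by auto
  have d: "((\<lambda>x. f (F x)) has_derivative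
      (\<lambda>v. frechet_derivative f (at (F x)) (frechet_derivative F (at x) v))) (at x)" if "x \<in> S" for x
    using fF[OF that] by (intro has_derivative_compose[of F _ _ _ f]) (simp_all flip: frechet_derivative_works)
  have "Ck_on k S (\<lambda>x. \<Sum>e\<in>Basis. (frechet_derivative F (at x) v \<bullet> e) *\<^sub>R
      frechet_derivative f (at (F x)) e)" for v
    using Suc.prems Suc.prems[THEN Ck_on_SucD]
    by (intro Ck_on_sum assms(1) Ck_on_bilinear[OF bounded_bilinear_scaleR]
        Ck_on_bilinear[OF bounded_bilinear_inner] Ck_on_const Suc.IH) auto
  then have "Ck_on k S (\<lambda>x. frechet_derivative (\<lambda>x. f (F x)) (at x) v)" for v
    by (rule Ck_on_cong[OF assms(1), rotated])
       (simp add: frechet_derivative_eq[OF d] linear_frechet_derivative fF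
           flip: linear_euclidean_sum)
  then show ?case using d by (auto simp: differentiable_def)
qed

section \<open>Smooth maps as the case of all orders\<close>

lemma smooth_on_differentiable: "smooth_on S f \<Longrightarrow> x \<in> S \<Longrightarrow> f differentiable (at x)"
  unfolding smooth_on_def by (drule spec[of _ "Suc 0"]) simp

lemma smooth_on_continuous: "smooth_on S f \<Longrightarrow> continuous_on S f"
  unfolding smooth_on_def by (drule spec[of _ 0]) simp

lemma smooth_on_frechet_derivative:
  "smooth_on S f \<Longrightarrow> smooth_on S (\<lambda>x. frechet_derivative f (at x) v)"
  unfolding smooth_on_def
proof
  fix k assume "\<forall>k. Ck_on k S f"
  then have "Ck_on (Suc k) S f" ..
  then have "\<forall>v. Ck_on k S (\<lambda>x. frechet_derivative f (at x) v)" by simp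
  then show "Ck_on k S (\<lambda>x. frechet_derivative f (at x) v)" ..
qed

lemma smooth_onI: "(\<And>k. Ck_on k S f) \<Longrightarrow> smooth_on S f"
  unfolding smooth_on_def by (rule allI)

lemma smooth_onD: "smooth_on S f \<Longrightarrow> Ck_on k S f"
  unfolding smooth_on_def by (rule spec)

lemma smooth_on_cong:
  "open S \<Longrightarrow> (\<And>x. x \<in> S \<Longrightarrow> f x = g x) \<Longrightarrow> smooth_on S f \<Longrightarrow> smooth_on S g"
  by (rule smooth_onI, rule Ck_on_cong[of S f g], assumption, assumption, rule smooth_onD)

lemma smooth_on_local:
  assumes "\<And>x. x \<in> S \<Longrightarrow> \<exists>U. open U \<and> x \<in> U \<and> smooth_on U f"
  shows "smooth_on S f"
proof (rule smooth_onI, rule Ck_on_local)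
  fix k x assume "x \<in> S"
  then obtain U where "open U" "x \<in> U" "smooth_on U f" using assms by blast
  then have "open U \<and> x \<in> U \<and> Ck_on k U f" by (simp add: smooth_onD)
  then show "\<exists>U. open U \<and> x \<in> U \<and> Ck_on k U f" ..
qed

lemma smooth_on_const: "smooth_on S (\<lambda>x. c)"
  by (rule smooth_onI, rule Ck_on_const)

lemma smooth_on_bounded_linear: "bounded_linear L \<Longrightarrow> smooth_on S L"
  by (rule smooth_onI, rule Ck_on_bounded_linear)

lemma smooth_on_add:
  "open S \<Longrightarrow> smooth_on S f \<Longrightarrow> smooth_on S g \<Longrightarrow> smooth_on S (\<lambda>x. f x + g x)"
  by (rule smooth_onI, rule Ck_on_add) (assumption | rule smooth_onD)+

lemma smooth_on_sum:
  "open S \<Longrightarrow> (\<And>i. i \<in> I \<Longrightarrow> smooth_on S (f i)) \<Longrightarrow> smooth_on S (\<lambda>x. \<Sum>i\<in>I. f i x)"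
  by (rule smooth_onI, rule Ck_on_sum[of S I _ f], assumption, rule smooth_onD)

lemma smooth_on_bilinear:
  "bounded_bilinear B \<Longrightarrow> open S \<Longrightarrow> smooth_on S f \<Longrightarrow> smooth_on S g \<Longrightarrow> smooth_on S (\<lambda>x. B (f x) (g x))"
  by (rule smooth_onI, rule Ck_on_bilinear[of B]) (assumption | rule smooth_onD)+

lemmas smooth_on_scaleR = smooth_on_bilinear[OF bounded_bilinear_scaleR]
lemmas smooth_on_inner = smooth_on_bilinear[OF bounded_bilinear_inner]

lemma smooth_on_compose:
  fixes F :: "'u::real_normed_vector \<Rightarrow> 'e::euclidean_space"
  assumes "open S" "open T" "F ` S \<subseteq> T" "smooth_on T f" "smooth_on S F"
  shows "smooth_on S (\<lambda>x. f (F x))"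
  by (rule smooth_onI, rule Ck_on_compose[of S T F _ f, OF assms(1-3)];
      rule smooth_onD, rule assms)

subsection \<open>A flat function\<close>

text \<open>A whole family instead of the case \<open>n = 0\<close> alone: derivatives of its
  members are combinations of members, so smoothness follows by one induction on the order, for all
  \<open>n\<close> at once.\<close>

definition flat :: "nat \<Rightarrow> real \<Rightarrow> real" where
  "flat n t = (if t > 0 then exp (- inverse t) * inverse t ^ n else 0)"

lemma flat_tendsto_0: "(flat n \<longlongrightarrow> 0) (at 0)"
proof -
  have "((\<lambda>t. exp (- inverse t) * inverse t ^ n) \<longlongrightarrow> 0) (at_right (0::real))"
  proof -
    have "((\<lambda>y. y ^ n / exp y) \<longlongrightarrow> 0) (at_top :: real filter)"
      by (rule tendsto_power_div_exp_0)
    then have "((\<lambda>t. inverse t ^ n / exp (inverse t)) \<longlongrightarrow> 0) (at_right (0::real))"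
      by (rule filterlim_compose[OF _ filterlim_inverse_at_top_right])
    then show ?thesis by (simp add: exp_minus field_simps)
  qed
  then have "(flat n \<longlongrightarrow> 0) (at_right 0)"
    by (rule Lim_transform_eventually) (auto simp: eventually_at_filter flat_def)
  moreover have "(flat n \<longlongrightarrow> 0) (at_left 0)"
    by (rule Lim_transform_eventually[OF tendsto_const]) (auto simp: eventually_at_filter flat_def)
  ultimately show ?thesis by (simp add: filterlim_split_at)
qed

lemma flat_has_derivative:
  "(flat n has_real_derivative (flat (n + 2) t - real n * flat (n + 1) t)) (at t)"
proof -
  consider "t > 0" | "t < 0" | "t = 0" by linarith
  then show ?thesis
  proof cases
    case 1
    have "((\<lambda>t. exp (- inverse t) * inverse t ^ n) has_real_derivative
        (flat (n + 2) t - real n * flat (n + 1) t)) (at t)"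
      using 1 by (auto intro!: derivative_eq_intros simp: flat_def algebra_simps power2_eq_square)
        (cases n; simp add: algebra_simps)
    then show ?thesis
      by (rule has_field_derivative_transform_within_open[of _ _ _ "{0<..}"]) (use 1 in \<open>auto simp: flat_def\<close>)
  next
    case 2
    have "((\<lambda>t. 0) has_real_derivative 0) (at t)" by simp
    then have "(flat n has_real_derivative 0) (at t)"
      by (rule has_field_derivative_transform_within_open[of _ _ _ "{..<0}"]) (use 2 in \<open>auto simp: flat_def\<close>)
    then show ?thesis using 2 by (simp add: flat_def)
  next
    case 3
    \<comment> \<open>The difference quotient of \<open>flat n\<close> at 0 is
      \<open>flat (n + 1)\<close>, whose limit is known.\<close>
    have "((\<lambda>h. (flat n (0 + h) - flat n 0) / h) \<longlongrightarrow> 0) (at 0)"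
      by (rule Lim_transform_eventually[OF flat_tendsto_0[of "n + 1"]])
         (auto simp: eventually_at_filter flat_def divide_inverse)
    then have "(flat n has_real_derivative 0) (at 0)" unfolding DERIV_def .
    then show ?thesis using 3 by (simp add: flat_def)
  qed
qed

lemma smooth_on_flat: "smooth_on UNIV (flat n)"
proof -
  have "Ck_on k UNIV (flat n)" for k
  proof (induction k arbitrary: n)
    case 0
    show ?case using flat_has_derivative
      by (auto intro!: continuous_at_imp_continuous_on DERIV_isCont)
  next
    case (Suc k)
    have d: "(flat n has_derivative (\<lambda>v. v * flat (n + 2) t + (- (v * real n)) * flat (n + 1) t)) (at t)" for t
      using flat_has_derivative[of n t] unfolding has_field_derivative_def
      by (rule has_derivative_eq_rhs) (auto simp: algebra_simps)
    have "Ck_on k UNIV (\<lambda>t. v * flat (n + 2) t + (- (v * real n)) * flat (n + 1) t)" for v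
      by (intro Ck_on_add Ck_on_bilinear[OF bounded_bilinear_mult] Ck_on_const Suc.IH) auto
    then show ?case using d by (auto simp: frechet_derivative_eq[OF d] differentiable_def)
  qed
  then show ?thesis unfolding smooth_on_def by blast
qed

lemma bump_function:
  fixes y0 :: "'e::euclidean_space"
  assumes "r > 0"
  obtains \<rho> :: "'e \<Rightarrow> real" where "smooth_on UNIV \<rho>" "\<rho> y0 = 1" "\<And>y. y \<notin> cball y0 r \<Longrightarrow> \<rho> y = 0"
proof
  \<comment> \<open>\<open>?q\<close> is positive exactly on the open ball of radius
    \<open>r\<close>; the squared distance keeps it smooth at the centre. The factor in
    \<open>?\<rho>\<close> normalises the value at \<open>y0\<close>, where \<open>?q\<close> equals
    \<open>r\<^sup>2\<close>.\<close>
  let ?q = "\<lambda>y. r\<^sup>2 + (- 1) *\<^sub>R ((y + - y0) \<bullet> (y + - y0))"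
  let ?\<rho> = "\<lambda>y. (1 / flat 0 (r\<^sup>2)) *\<^sub>R flat 0 (?q y)"
  have d: "smooth_on UNIV (\<lambda>y. y + - y0)"
    by (intro smooth_on_add smooth_on_bounded_linear[OF bounded_linear_ident] smooth_on_const open_UNIV)
  have "smooth_on UNIV ?q"
    by (rule smooth_on_add[OF open_UNIV smooth_on_const
          smooth_on_scaleR[OF open_UNIV smooth_on_const smooth_on_inner[OF open_UNIV d d]]])
  then have "smooth_on UNIV (\<lambda>y. flat 0 (?q y))"
    by (intro smooth_on_compose[of UNIV UNIV ?q "flat 0"] smooth_on_flat) auto
  then show "smooth_on UNIV ?\<rho>"
    by (intro smooth_on_scaleR smooth_on_const open_UNIV)
  show "?\<rho> y0 = 1" using assms by (simp add: flat_def)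
  show "?\<rho> y = 0" if "y \<notin> cball y0 r" for y
  proof -
    have "r < norm (y - y0)" using that by (simp add: dist_norm norm_minus_commute)
    then have "r\<^sup>2 < (norm (y - y0))\<^sup>2" using assms by (intro power_strict_mono) auto
    then show ?thesis by (simp add: flat_def dot_square_norm)
  qed
qed


subsection \<open>Second derivatives\<close>

text \<open>The mean value theorem is applied twice: along \<open>u\<close> to a difference of
  values of \<open>f\<close>, then along \<open>v\<close> to a difference of values of its
  derivative. The second difference is symmetric in \<open>u\<close> and \<open>v\<close>, the
  derivative on the right is not; exchanging the roles therefore compares the two mixed
  derivatives.\<close>

lemma second_difference_mean_value:
  fixes f :: "'u::real_normed_vector \<Rightarrow> real"
  assumes f: "\<And>y. y \<in> ball x \<delta> \<Longrightarrow> f differentiable (at y)"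
    and Df: "\<And>y. y \<in> ball x \<delta> \<Longrightarrow> (\<lambda>z. frechet_derivative f (at z) u) differentiable (at y)"
    and t: "0 < t" "t * norm u + t * norm v < \<delta>"
  obtains \<xi> where "\<xi> \<in> ball x \<delta>"
    "f (x + t *\<^sub>R u + t *\<^sub>R v) - f (x + t *\<^sub>R u) - f (x + t *\<^sub>R v) + f x
       = t * t * frechet_derivative (\<lambda>z. frechet_derivative f (at z) u) (at \<xi>) v"
proof -
  have inb: "x + s *\<^sub>R u + r *\<^sub>R v \<in> ball x \<delta>" if "0 \<le> s" "s \<le> t" "0 \<le> r" "r \<le> t" for s r
  proof -
    have "dist x (x + s *\<^sub>R u + r *\<^sub>R v) = norm (s *\<^sub>R u + r *\<^sub>R v)"
      by (subst dist_commute) (simp add: dist_norm add.assoc)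
    also have "\<dots> \<le> s * norm u + r * norm v"
      using norm_triangle_ineq[of "s *\<^sub>R u" "r *\<^sub>R v"] that by simp
    also have "\<dots> \<le> t * norm u + t * norm v"
      using that by (intro add_mono mult_right_mono) auto
    finally show ?thesis using t by simp
  qed
  let ?D = "\<lambda>y. frechet_derivative f (at y) u"
  \<comment> \<open>The zero multiple of \<open>v\<close> makes both terms instances of
    \<open>d1\<close>, with \<open>r = t\<close> and \<open>r = 0\<close>.\<close>
  let ?\<phi> = "\<lambda>s. f (x + s *\<^sub>R u + t *\<^sub>R v) - f (x + s *\<^sub>R u + 0 *\<^sub>R v)"
  have d1: "((\<lambda>s. f (x + s *\<^sub>R u + r *\<^sub>R v)) has_real_derivative ?D (x + s *\<^sub>R u + r *\<^sub>R v)) (at s)"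
    if "0 \<le> s" "s \<le> t" "0 \<le> r" "r \<le> t" for s r
  proof -
    have fd: "(f has_derivative frechet_derivative f (at (x + s *\<^sub>R u + r *\<^sub>R v))) (at (x + s *\<^sub>R u + r *\<^sub>R v))"
      using f[OF inb[OF that]] by (simp flip: frechet_derivative_works)
    have "((\<lambda>s. f (x + s *\<^sub>R u + r *\<^sub>R v)) has_derivative
        (\<lambda>h. frechet_derivative f (at (x + s *\<^sub>R u + r *\<^sub>R v)) (h *\<^sub>R u))) (at s)"
      by (rule has_derivative_compose[where f = "\<lambda>s. x + s *\<^sub>R u + r *\<^sub>R v", OF _ fd])
         (auto intro!: derivative_eq_intros)
    then show ?thesis unfolding has_field_derivative_def
      by (rule has_derivative_eq_rhs)
         (simp add: linear_cmul linear_frechet_derivative[OF f[OF inb[OF that]]] fun_eq_iff)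
  qed
  have "\<exists>s>0. s < t \<and> ?\<phi> t - ?\<phi> 0 = (t - 0) * (?D (x + s *\<^sub>R u + t *\<^sub>R v) - ?D (x + s *\<^sub>R u + 0 *\<^sub>R v))"
    using t(1) by (intro MVT2 DERIV_diff d1) auto
  then obtain s where s: "0 < s" "s < t"
    "?\<phi> t - ?\<phi> 0 = t * (?D (x + s *\<^sub>R u + t *\<^sub>R v) - ?D (x + s *\<^sub>R u + 0 *\<^sub>R v))" by auto
  let ?DD = "\<lambda>y. frechet_derivative ?D (at y) v"
  have d2: "((\<lambda>r. ?D (x + s *\<^sub>R u + r *\<^sub>R v)) has_real_derivative ?DD (x + s *\<^sub>R u + r *\<^sub>R v)) (at r)"
    if "0 \<le> r" "r \<le> t" for r
  proof -
    have i: "x + s *\<^sub>R u + r *\<^sub>R v \<in> ball x \<delta>" using s that by (intro inb) auto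
    have fd: "(?D has_derivative frechet_derivative ?D (at (x + s *\<^sub>R u + r *\<^sub>R v))) (at (x + s *\<^sub>R u + r *\<^sub>R v))"
      using Df[OF i] by (simp flip: frechet_derivative_works)
    have "((\<lambda>r. ?D (x + s *\<^sub>R u + r *\<^sub>R v)) has_derivative
        (\<lambda>h. frechet_derivative ?D (at (x + s *\<^sub>R u + r *\<^sub>R v)) (h *\<^sub>R v))) (at r)"
      by (rule has_derivative_compose[where f = "\<lambda>r. x + s *\<^sub>R u + r *\<^sub>R v", OF _ fd])
         (auto intro!: derivative_eq_intros)
    then show ?thesis unfolding has_field_derivative_def
      by (rule has_derivative_eq_rhs)
         (simp add: linear_cmul linear_frechet_derivative[OF Df[OF i]] fun_eq_iff)
  qed
  have "\<exists>r>0. r < t \<and> ?D (x + s *\<^sub>R u + t *\<^sub>R v) - ?D (x + s *\<^sub>R u + 0 *\<^sub>R v)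
      = (t - 0) * ?DD (x + s *\<^sub>R u + r *\<^sub>R v)"
    using t(1) by (intro MVT2 d2) auto
  then obtain r where r: "0 < r" "r < t"
    "?D (x + s *\<^sub>R u + t *\<^sub>R v) - ?D (x + s *\<^sub>R u + 0 *\<^sub>R v) = t * ?DD (x + s *\<^sub>R u + r *\<^sub>R v)" by auto
  show ?thesis
  proof (rule that)
    show "x + s *\<^sub>R u + r *\<^sub>R v \<in> ball x \<delta>" using s r by (intro inb) auto
    show "f (x + t *\<^sub>R u + t *\<^sub>R v) - f (x + t *\<^sub>R u) - f (x + t *\<^sub>R v) + f x
       = t * t * ?DD (x + s *\<^sub>R u + r *\<^sub>R v)"
      using s(3) unfolding r(3) by simp
  qed
qed

text \<open>If the mixed derivatives differed at \<open>x\<close>, continuity would keep them apart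
  nearby. But one and the same second difference, divided by the square of the step, is a value of
  each of them at some point near \<open>x\<close>.\<close>

lemma second_derivative_symmetric_real:
  fixes f :: "'u::real_normed_vector \<Rightarrow> real"
  assumes "open S" "x \<in> S" "smooth_on S f"
  shows "frechet_derivative (\<lambda>y. frechet_derivative f (at y) u) (at x) v
       = frechet_derivative (\<lambda>y. frechet_derivative f (at y) v) (at x) u"
proof (rule ccontr)
  define P where "P u v y = frechet_derivative (\<lambda>y. frechet_derivative f (at y) u) (at y) v" for u v y
  assume "\<not> ?thesis"
  \<comment> \<open>Half the distance: two values that are each closer than this to their own limit
    cannot coincide.\<close>
  then have ne: "0 < dist (P u v x) (P v u x) / 2" by (simp add: P_def)
  have sm: "smooth_on S (\<lambda>y. frechet_derivative f (at y) u)" for u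
    using assms(3) by (rule smooth_on_frechet_derivative)
  have cont: "isCont (P u v) x" for u v
    using smooth_on_continuous[OF smooth_on_frechet_derivative[OF sm]] assms
    unfolding P_def by (simp add: continuous_on_eq_continuous_at)
  have near: "\<exists>d>0. \<forall>y. dist y x < d \<longrightarrow> dist (P u v y) (P u v x) < e" if "e > 0" for u v e
    using cont[of u v] that unfolding continuous_at_eps_delta dist_real_def dist_norm by auto
  obtain d1 where d1: "d1 > 0" "\<And>y. dist y x < d1 \<Longrightarrow> dist (P u v y) (P u v x) < dist (P u v x) (P v u x) / 2"
    using near[OF ne, of u v] by blast
  obtain d2 where d2: "d2 > 0" "\<And>y. dist y x < d2 \<Longrightarrow> dist (P v u y) (P v u x) < dist (P u v x) (P v u x) / 2"
    using near[OF ne, of v u] by blast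
  obtain d3 where d3: "d3 > 0" "ball x d3 \<subseteq> S" using assms openE by blast
  define \<delta> where "\<delta> = min d1 (min d2 d3)"
  have \<delta>: "\<delta> > 0" "ball x \<delta> \<subseteq> S" using d1 d2 d3 by (auto simp: \<delta>_def)
  \<comment> \<open>The summand 1 covers the case that \<open>u\<close> and \<open>v\<close> vanish
    and makes the bound below strict.\<close>
  define t where "t = \<delta> / (norm u + norm v + 1)"
  have den: "0 < norm u + norm v + 1" by (simp add: add_nonneg_pos)
  then have t0: "t > 0" using \<delta> by (simp add: t_def)
  have "t * norm u + t * norm v < t * (norm u + norm v + 1)"
    using t0 by (simp add: algebra_simps)
  then have t1: "t * norm u + t * norm v < \<delta>" using den by (simp add: t_def)
  have df: "f differentiable (at y)" "(\<lambda>z. frechet_derivative f (at z) w) differentiable (at y)"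
    if "y \<in> ball x \<delta>" for y w
    using smooth_on_differentiable[OF assms(3)] smooth_on_differentiable[OF sm] that \<delta>(2) by blast+
  obtain \<xi> where \<xi>: "\<xi> \<in> ball x \<delta>"
    "f (x + t *\<^sub>R u + t *\<^sub>R v) - f (x + t *\<^sub>R u) - f (x + t *\<^sub>R v) + f x = t * t * P u v \<xi>"
    using second_difference_mean_value[of x \<delta> f u t v] df t0 t1 unfolding P_def by blast
  obtain \<zeta> where \<zeta>: "\<zeta> \<in> ball x \<delta>"
    "f (x + t *\<^sub>R v + t *\<^sub>R u) - f (x + t *\<^sub>R v) - f (x + t *\<^sub>R u) + f x = t * t * P v u \<zeta>"
    using second_difference_mean_value[of x \<delta> f v t u] df t0 t1 unfolding P_def by (metis add.commute)
  have comm: "x + t *\<^sub>R v + t *\<^sub>R u = x + t *\<^sub>R u + t *\<^sub>R v" by simp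
  have "t * t * P u v \<xi> = t * t * P v u \<zeta>" using \<xi>(2) \<zeta>(2)[unfolded comm] by linarith
  then have "P u v \<xi> = P v u \<zeta>" using t0 by simp
  moreover have "dist (P u v \<xi>) (P u v x) < dist (P u v x) (P v u x) / 2"
    "dist (P v u \<zeta>) (P v u x) < dist (P u v x) (P v u x) / 2"
    by (rule d1(2) d2(2), use \<xi>(1) \<zeta>(1) in \<open>simp add: \<delta>_def dist_commute\<close>)+
  ultimately show False
    using dist_triangle3[of "P u v x" "P v u x" "P v u \<zeta>"] by simp
qed

lemma second_derivative_symmetric:
  fixes F :: "'u::real_normed_vector \<Rightarrow> 'e::euclidean_space"
  assumes "open S" "x \<in> S" "smooth_on S F"
  shows "frechet_derivative (\<lambda>y. frechet_derivative F (at y) u) (at x) v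
       = frechet_derivative (\<lambda>y. frechet_derivative F (at y) v) (at x) u"
proof (rule euclidean_eqI)
  fix e :: 'e assume "e \<in> Basis"
  have inner: "frechet_derivative (\<lambda>y. G y \<bullet> e) (at y) w = frechet_derivative G (at y) w \<bullet> e"
    if "G differentiable (at y)" for G :: "'u \<Rightarrow> 'e" and y w
  proof -
    have "((\<lambda>y. G y \<bullet> e) has_derivative (\<lambda>w. frechet_derivative G (at y) w \<bullet> e)) (at y)"
      by (rule has_derivative_inner_left) (use that in \<open>simp flip: frechet_derivative_works\<close>)
    then show ?thesis by (simp add: frechet_derivative_eq)
  qed
  have sm: "smooth_on S (\<lambda>y. frechet_derivative F (at y) u)" for u
    using assms(3) by (rule smooth_on_frechet_derivative)
  have e: "frechet_derivative (\<lambda>y. frechet_derivative (\<lambda>y. F y \<bullet> e) (at y) u) (at x) v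
      = frechet_derivative (\<lambda>y. frechet_derivative F (at y) u) (at x) v \<bullet> e" for u v
  proof -
    have "frechet_derivative (\<lambda>y. frechet_derivative (\<lambda>y. F y \<bullet> e) (at y) u) (at x)
        = frechet_derivative (\<lambda>y. frechet_derivative F (at y) u \<bullet> e) (at x)"
      by (rule frechet_derivative_cong_open[OF assms(1,2)])
         (simp add: inner smooth_on_differentiable[OF assms(3)])
    then show ?thesis using inner[OF smooth_on_differentiable[OF sm assms(2)]] by simp
  qed
  have "smooth_on S (\<lambda>y. F y \<bullet> e)"
    by (rule smooth_on_inner[OF assms(1,3) smooth_on_const])
  from second_derivative_symmetric_real[OF assms(1,2) this, of u v]
  show "frechet_derivative (\<lambda>y. frechet_derivative F (at y) u) (at x) v \<bullet> e
      = frechet_derivative (\<lambda>y. frechet_derivative F (at y) v) (at x) u \<bullet> e"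
    by (simp add: e)
qed

subsection \<open>Product rule for fields of bilinear forms\<close>

text \<open>A spanning family with bounded coefficient functionals, in place of a basis.
  Independence is not part of it: on the model space of a submanifold the family is indexed by the
  basis of the ambient model space and is in general longer than a basis.\<close>

definition frame :: "'i set \<Rightarrow> ('i \<Rightarrow> 'v::real_normed_vector) \<Rightarrow> ('i \<Rightarrow> 'v \<Rightarrow> real) \<Rightarrow> bool" where
  "frame I b l \<longleftrightarrow> finite I \<and> (\<forall>i\<in>I. bounded_linear (l i)) \<and> (\<forall>v. v = (\<Sum>i\<in>I. l i v *\<^sub>R b i))"

lemma frame_Basis: "frame (Basis :: 'e::euclidean_space set) (\<lambda>e. e) (\<lambda>e v. v \<bullet> e)"
  by (simp add: frame_def bounded_linear_inner_left euclidean_representation)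

text \<open>On a space that embeds linearly into a Euclidean space, all linear functionals extend to
  the Euclidean space and hence are bounded.\<close>

lemma frame_of_embedding:
  fixes L :: "'v::real_normed_vector \<Rightarrow> 'e::euclidean_space"
  assumes "bounded_linear L" "inj L"
  obtains b where "frame (Basis :: 'e set) b (\<lambda>e v. L v \<bullet> e)"
proof -
  obtain g where g: "linear g" "g \<circ> L = id"
    using linear_injective_left_inverse[OF bounded_linear.linear[OF assms(1)] assms(2)] by blast
  have "v = (\<Sum>e\<in>Basis. (L v \<bullet> e) *\<^sub>R g e)" for v
    using linear_euclidean_sum[OF g(1), of "L v"] g(2) by (metis comp_apply id_apply)
  moreover have "bounded_linear (\<lambda>v. L v \<bullet> e)" for e
    using assms(1) bounded_linear_inner_left by (rule bounded_linear_compose[rotated])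
  ultimately show ?thesis using that[of g] by (simp add: frame_def)
qed

lemma frame_bilinear:
  assumes "frame I b l" "bilinear B"
  shows "B u v = (\<Sum>i\<in>I. \<Sum>j\<in>I. l i u * (l j v * B (b i) (b j)))"
proof -
  have lin: "linear (B u)" "linear (\<lambda>u. B u v)" for u v
    using assms(2) by (auto simp: bilinear_def)
  have "B u v = (\<Sum>i\<in>I. l i u * B (b i) v)" for u v
  proof -
    have "B (\<Sum>i\<in>I. l i u *\<^sub>R b i) v = (\<Sum>i\<in>I. l i u * B (b i) v)"
      using lin(2) by (simp add: linear_sum[of "\<lambda>u. B u v"] linear_cmul[of "\<lambda>u. B u v"])
    then show ?thesis using assms(1) unfolding frame_def by metis
  qed
  moreover have "B u v = (\<Sum>j\<in>I. l j v * B u (b j))" for u v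
  proof -
    have "B u (\<Sum>i\<in>I. l i v *\<^sub>R b i) = (\<Sum>i\<in>I. l i v * B u (b i))"
      using lin(1) by (simp add: linear_sum linear_cmul)
    then show ?thesis using assms(1) unfolding frame_def by metis
  qed
  ultimately show ?thesis by (metis (no_types, lifting) sum.cong sum_distrib_left)
qed

text \<open>\<open>bilinear\<close> is purely algebraic, and the differentiability of
  \<open>h\<close> is given for fixed arguments only. The frame expands \<open>h\<close> into
  finitely many scalar coefficients, to which the ordinary product rule applies; the resulting sums
  are folded back into values of \<open>h\<close>.\<close>

lemma bilinear_field_has_derivative:
  fixes h :: "'u::real_normed_vector \<Rightarrow> 'v::real_normed_vector \<Rightarrow> 'v \<Rightarrow> real"
    and b :: "'i \<Rightarrow> 'v"
  assumes fr: "frame I b l"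
    and U: "open U" "x \<in> U" "\<And>y. y \<in> U \<Longrightarrow> bilinear (h y)"
    and h: "\<And>u v. (\<lambda>y. h y u v) differentiable (at x)"
    and Y: "(Y has_derivative Y') (at x)" and Z: "(Z has_derivative Z') (at x)"
  shows "((\<lambda>y. h y (Y y) (Z y)) has_derivative
      (\<lambda>w. frechet_derivative (\<lambda>y. h y (Y x) (Z x)) (at x) w + h x (Y' w) (Z x) + h x (Y x) (Z' w))) (at x)"
proof -
  have ex: "h y u v = (\<Sum>i\<in>I. \<Sum>j\<in>I. l i u * (l j v * h y (b i) (b j)))" if "y \<in> U" for y u v
    using frame_bilinear[OF fr U(3)[OF that]] .
  have l: "i \<in> I \<Longrightarrow> bounded_linear (l i)" for i using fr by (simp add: frame_def)
  let ?D = "\<lambda>i j. frechet_derivative (\<lambda>y. h y (b i) (b j)) (at x)"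
  have D: "((\<lambda>y. h y (b i) (b j)) has_derivative ?D i j) (at x)" for i j
    using h by (simp flip: frechet_derivative_works)
  have Dh: "((\<lambda>y. h y u v) has_derivative
      (\<lambda>w. \<Sum>i\<in>I. \<Sum>j\<in>I. l i u * (l j v * ?D i j w))) (at x)" for u v
    by (rule has_derivative_transform_within_open[OF _ U(1,2) ex[symmetric]])
       (auto intro!: derivative_eq_intros D)
  have lY: "((\<lambda>y. l i (Y y)) has_derivative (\<lambda>w. l i (Y' w))) (at x)"
    and lZ: "((\<lambda>y. l i (Z y)) has_derivative (\<lambda>w. l i (Z' w))) (at x)" if "i \<in> I" for i
    using bounded_linear.has_derivative[OF l[OF that]] Y Z by blast+
  have "((\<lambda>y. \<Sum>i\<in>I. \<Sum>j\<in>I. l i (Y y) * (l j (Z y) * h y (b i) (b j))) has_derivative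
     (\<lambda>w. \<Sum>i\<in>I. \<Sum>j\<in>I. l i (Y x) * (l j (Z x) * ?D i j w + l j (Z' w) * h x (b i) (b j))
        + l i (Y' w) * (l j (Z x) * h x (b i) (b j)))) (at x)"
    by (intro has_derivative_sum has_derivative_mult D lY lZ)
  then have "((\<lambda>y. h y (Y y) (Z y)) has_derivative
     (\<lambda>w. \<Sum>i\<in>I. \<Sum>j\<in>I. l i (Y x) * (l j (Z x) * ?D i j w + l j (Z' w) * h x (b i) (b j))
        + l i (Y' w) * (l j (Z x) * h x (b i) (b j)))) (at x)"
    by (rule has_derivative_transform_within_open[OF _ U(1,2)]) (simp only: ex[of _ "Y _" "Z _"])
  moreover have "(\<Sum>i\<in>I. \<Sum>j\<in>I. l i (Y x) * (l j (Z x) * ?D i j w + l j (Z' w) * h x (b i) (b j))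
        + l i (Y' w) * (l j (Z x) * h x (b i) (b j)))
      = frechet_derivative (\<lambda>y. h y (Y x) (Z x)) (at x) w + h x (Y' w) (Z x) + h x (Y x) (Z' w)" for w
    unfolding frechet_derivative_eq[OF Dh[of "Y x" "Z x"]] ex[OF U(2), of "Y' w" "Z x"] ex[OF U(2), of "Y x" "Z' w"]
    by (simp add: sum.distrib distrib_left)
  ultimately show ?thesis by simp
qed

section \<open>Charts and tangent vectors\<close>

lemma component_simps [simp]:
  "component (Tvec f) = f"
  "component 0 c = 0"
  "component (u + v) c = component u c + component v c"
  "component (u - v) c = component u c - component v c"
  "component (- u) c = - component u c"
  "component (r *\<^sub>R u) c = r *\<^sub>R component u c"
  by (simp_all add: Tvec_inverse zero_tvec_def plus_tvec_def minus_tvec_def uminus_tvec_def scaleR_tvec_def)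

lemma tvec_eqI: "(\<And>c. component u c = component v c) \<Longrightarrow> u = v"
  by (metis component_inject ext)

definition chart_jacobian ::
    "('a, 'u::real_normed_vector) chart \<Rightarrow> ('a, 'v::real_normed_vector) chart \<Rightarrow> 'a \<Rightarrow> 'u \<Rightarrow> 'v" where
  "chart_jacobian c d p = frechet_derivative (local_rep c d (\<lambda>p. p)) (at (snd c p))"

text \<open>The two charts may have different model spaces: besides pairs of charts of one manifold, the
  notion covers a chart of a submanifold and a chart of the ambient manifold.\<close>

definition compatible ::
    "('a, 'u::real_normed_vector) chart \<Rightarrow> ('a, 'v::real_normed_vector) chart \<Rightarrow> bool" where
  "compatible c d \<longleftrightarrow> inj_on (snd c) (fst c) \<and> open (snd c ` (fst c \<inter> fst d)) \<and>
     smooth_on (snd c ` (fst c \<inter> fst d)) (local_rep c d (\<lambda>p. p))"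

lemma chart_inv_snd: "inj_on (snd c) (fst c) \<Longrightarrow> q \<in> fst c \<Longrightarrow> chart_inv c (snd c q) = q"
  by (simp add: chart_inv_def)

lemma local_rep_ident:
  "compatible c d \<Longrightarrow> q \<in> fst c \<Longrightarrow> local_rep c d (\<lambda>p. p) (snd c q) = snd d q"
  by (simp add: local_rep_def chart_inv_snd compatible_def)

lemma local_rep_differentiable:
  "compatible c d \<Longrightarrow> q \<in> fst c \<Longrightarrow> q \<in> fst d \<Longrightarrow>
     local_rep c d (\<lambda>p. p) differentiable (at (snd c q))"
  unfolding compatible_def by (blast intro: smooth_on_differentiable)

lemma local_rep_has_derivative:
  "compatible c d \<Longrightarrow> q \<in> fst c \<Longrightarrow> q \<in> fst d \<Longrightarrow>
     (local_rep c d (\<lambda>p. p) has_derivative chart_jacobian c d q) (at (snd c q))"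
  unfolding chart_jacobian_def by (simp add: local_rep_differentiable flip: frechet_derivative_works)

lemma chart_jacobian_bounded_linear:
  "compatible c d \<Longrightarrow> q \<in> fst c \<Longrightarrow> q \<in> fst d \<Longrightarrow> bounded_linear (chart_jacobian c d q)"
  by (rule has_derivative_bounded_linear[OF local_rep_has_derivative])

lemma chart_jacobian_linear:
  "compatible c d \<Longrightarrow> q \<in> fst c \<Longrightarrow> q \<in> fst d \<Longrightarrow> linear (chart_jacobian c d q)"
  by (simp add: chart_jacobian_bounded_linear bounded_linear.linear)

lemma chart_jacobian_smooth:
  assumes "compatible c d"
  shows "smooth_on (snd c ` (fst c \<inter> fst d)) (\<lambda>x. chart_jacobian c d (chart_inv c x) u)"
proof -
  have "smooth_on (snd c ` (fst c \<inter> fst d)) (\<lambda>x. frechet_derivative (local_rep c d (\<lambda>p. p)) (at x) u)"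
    using assms by (intro smooth_on_frechet_derivative) (simp add: compatible_def)
  then show ?thesis
    by (rule smooth_on_cong[rotated 2])
       (use assms in \<open>auto simp: compatible_def chart_jacobian_def chart_inv_snd\<close>)
qed

text \<open>Chain rule on the overlap of the three domains. For charts of one manifold this is the
  cocycle rule behind tangent vectors; for charts of a submanifold and of the ambient manifold it
  says that the differential of the inclusion does not depend on the charts.\<close>

lemma chart_jacobian_compose:
  assumes cd: "compatible c d" and de: "compatible d e" and ce: "compatible c e"
    and q: "q \<in> fst c" "q \<in> fst d" "q \<in> fst e"
  shows "chart_jacobian d e q (chart_jacobian c d q u) = chart_jacobian c e q u"
proof -
  let ?U = "snd c ` (fst c \<inter> fst d) \<inter> snd c ` (fst c \<inter> fst e)"
  have eq: "local_rep d e (\<lambda>p. p) (local_rep c d (\<lambda>p. p) x) = local_rep c e (\<lambda>p. p) x" if "x \<in> ?U" for x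
  proof -
    obtain q q' where q: "x = snd c q" "q \<in> fst c" "q \<in> fst d"
      and q': "x = snd c q'" "q' \<in> fst c" "q' \<in> fst e"
      using \<open>x \<in> ?U\<close> by blast
    then have "q = q'" using cd by (auto simp: compatible_def dest: inj_onD)
    note q q'[folded \<open>q = q'\<close>]
    then show ?thesis using cd de ce by (simp add: local_rep_ident)
  qed
  have U: "open ?U" "snd c q \<in> ?U" using cd ce q by (auto simp: compatible_def)
  have "((\<lambda>x. local_rep d e (\<lambda>p. p) (local_rep c d (\<lambda>p. p) x)) has_derivative
      (\<lambda>u. chart_jacobian d e q (chart_jacobian c d q u))) (at (snd c q))"
    by (rule has_derivative_compose[OF local_rep_has_derivative[OF cd q(1,2)]])
       (use local_rep_has_derivative[OF de q(2,3)] in \<open>simp add: local_rep_ident[OF cd q(1)]\<close>)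
  then have "(local_rep c e (\<lambda>p. p) has_derivative (\<lambda>u. chart_jacobian d e q (chart_jacobian c d q u))) (at (snd c q))"
    by (rule has_derivative_transform_within_open[OF _ U eq])
  then show ?thesis by (simp add: chart_jacobian_def[of c e] frechet_derivative_eq)
qed

lemma chart_jacobian_self:
  assumes "compatible c c" "q \<in> fst c"
  shows "chart_jacobian c c q u = u"
proof -
  have "((\<lambda>x. x) has_derivative (\<lambda>u. u)) (at (snd c q))" by simp
  then have "(local_rep c c (\<lambda>p. p) has_derivative (\<lambda>u. u)) (at (snd c q))"
    by (rule has_derivative_transform_within_open[of _ _ _ _ "snd c ` fst c"])
       (use assms in \<open>auto simp: local_rep_ident compatible_def\<close>)
  then show ?thesis by (simp add: chart_jacobian_def frechet_derivative_eq)
qed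

section \<open>Charts of manifolds and of submanifolds\<close>

lemma chart_properties:
  assumes "smooth_manifold m M" "c \<in> atlas M"
  shows "openin (mtop M) (fst c)" "open (snd c ` fst c)" "fst c \<subseteq> carrier M"
    "homeomorphic_map (subtopology (mtop M) (fst c)) (top_of_set (snd c ` fst c)) (snd c)"
    "inj_on (snd c) (fst c)"
proof -
  show *: "openin (mtop M) (fst c)" "open (snd c ` fst c)"
    "homeomorphic_map (subtopology (mtop M) (fst c)) (top_of_set (snd c ` fst c)) (snd c)"
    using assms by (auto simp: smooth_manifold_def)
  show "fst c \<subseteq> carrier M" using *(1) by (simp add: carrier_def openin_subset)
  then show "inj_on (snd c) (fst c)"
    using homeomorphic_imp_injective_map[OF *(3)] by (simp add: carrier_def Int_absorb1)
qed

lemma open_chart_image: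
  assumes "smooth_manifold m M" "c \<in> atlas M" "openin (mtop M) U"
  shows "open (snd c ` (fst c \<inter> U))"
proof -
  have "openin (subtopology (mtop M) (fst c)) (fst c \<inter> U)"
    using assms(3) by (auto simp: openin_subtopology)
  then have "openin (top_of_set (snd c ` fst c)) (snd c ` (fst c \<inter> U))"
    using homeomorphic_imp_open_map[OF chart_properties(4)[OF assms(1,2)]] by (simp add: open_map_def)
  then show ?thesis using chart_properties(2)[OF assms(1,2)] by (simp add: openin_open_eq)
qed

lemma compatible_atlas:
  assumes "smooth_manifold m M" "c \<in> atlas M" "d \<in> atlas M"
  shows "compatible c d"
  unfolding compatible_def
proof (intro conjI)
  show "inj_on (snd c) (fst c)" by (rule chart_properties(5)[OF assms(1,2)])
  show "open (snd c ` (fst c \<inter> fst d))"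
    by (rule open_chart_image[OF assms(1,2) chart_properties(1)[OF assms(1,3)]])
  show "smooth_on (snd c ` (fst c \<inter> fst d)) (local_rep c d (\<lambda>p. p))"
    using assms by (simp add: smooth_manifold_def transition_def)
qed

text \<open>Continuity of the inclusion makes the part of \<open>M\<close> in the domain of
  \<open>d\<close> open, also when the topology of \<open>M\<close> is finer than the induced one;
  the rest is the definition of a smooth map.\<close>

lemma compatible_submanifold:
  assumes "smooth_manifold m M" "smooth_manifold n N" "smooth_map M N (\<lambda>p. p)" "c \<in> atlas M" "d \<in> atlas N"
  shows "compatible c d"
proof -
  have "openin (mtop M) {p \<in> topspace (mtop M). p \<in> fst d}"
    using assms(3) chart_properties(1)[OF assms(2,5)]
    by (auto simp: smooth_map_def continuous_map_def)
  then have "open (snd c ` (fst c \<inter> {p \<in> topspace (mtop M). p \<in> fst d}))"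
    by (rule open_chart_image[OF assms(1,4)])
  moreover have "fst c \<inter> {p \<in> topspace (mtop M). p \<in> fst d} = fst c \<inter> fst d"
    using chart_properties(3)[OF assms(1,4)] by (auto simp: carrier_def)
  moreover have "{p \<in> fst c. p \<in> fst d} = fst c \<inter> fst d" by auto
  ultimately show ?thesis
    using assms(3-5) chart_properties(5)[OF assms(1,4)] unfolding compatible_def smooth_map_def by force
qed

lemma charts_atD: "c \<in> charts_at M p \<Longrightarrow> c \<in> atlas M" "c \<in> charts_at M p \<Longrightarrow> p \<in> fst c"
  by (auto simp: charts_at_def)

lemma chart_inv_charts_atD:
  assumes "smooth_manifold m M" "c \<in> charts_at M p"
  shows "chart_inv c (snd c p) = p" "p \<in> carrier M"
  using chart_inv_snd[OF chart_properties(5)[OF assms(1) charts_atD(1)[OF assms(2)]] charts_atD(2)[OF assms(2)]]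
    chart_properties(3)[OF assms(1) charts_atD(1)[OF assms(2)]] charts_atD(2)[OF assms(2)]
  by auto

lemma compatible_charts_at:
  "smooth_manifold m M \<Longrightarrow> c \<in> charts_at M p \<Longrightarrow> d \<in> charts_at M q \<Longrightarrow> compatible c d"
  by (simp add: compatible_atlas charts_atD)

lemma chart_jacobian_compose_charts_at:
  assumes "smooth_manifold m M" "c \<in> charts_at M p" "d \<in> charts_at M p" "e \<in> charts_at M p"
  shows "chart_jacobian d e p (chart_jacobian c d p u) = chart_jacobian c e p u"
  using assms by (intro chart_jacobian_compose compatible_charts_at[OF assms(1)] charts_atD(2))

lemma some_chart_at:
  assumes "smooth_manifold m M" "p \<in> carrier M"
  shows "(SOME c. c \<in> charts_at M p) \<in> charts_at M p"
proof (rule someI_ex)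
  show "\<exists>c. c \<in> charts_at M p"
    using assms unfolding smooth_manifold_def charts_at_def by blast
qed

lemma chart_inv_charts_at:
  assumes "smooth_manifold m M" "c \<in> atlas M" "x \<in> snd c ` fst c"
  shows "c \<in> charts_at M (chart_inv c x)" "snd c (chart_inv c x) = x" "chart_inv c x \<in> carrier M"
proof -
  have i: "chart_inv c x \<in> fst c" using assms(3) by (simp add: chart_inv_def inv_into_into)
  then show "c \<in> charts_at M (chart_inv c x)" using assms(2) by (simp add: charts_at_def)
  show "snd c (chart_inv c x) = x" using assms(3) by (simp add: chart_inv_def f_inv_into_f)
  show "chart_inv c x \<in> carrier M" using i chart_properties(3)[OF assms(1,2)] by blast
qed

section \<open>Tangent vectors in coordinates\<close>

lemma tangent_space_iff:
  "v \<in> tangent_space M p \<longleftrightarrow>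
     (\<forall>c\<in>charts_at M p. \<forall>d\<in>charts_at M p. component v d = chart_jacobian c d p (component v c)) \<and>
     (\<forall>c. c \<notin> charts_at M p \<longrightarrow> component v c = 0)"
  by (simp add: tangent_space_def chart_jacobian_def transition_def)

lemma component_coord_field:
  "component (coord_field M c u p) d = (if d \<in> charts_at M p then chart_jacobian c d p u else 0)"
  by (simp add: coord_field_def chart_jacobian_def transition_def)

lemma component_coord_field_self:
  assumes "smooth_manifold m M" "c \<in> charts_at M p"
  shows "component (coord_field M c u p) c = u"
  using assms by (simp add: component_coord_field chart_jacobian_self compatible_charts_at charts_atD)

lemma tangent_space_subspace:
  assumes "smooth_manifold m M"
  shows "subspace (tangent_space M p)"
proof -
  have lin: "linear (chart_jacobian c d p)" if "c \<in> charts_at M p" "d \<in> charts_at M p" for c d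
    using that assms by (simp add: chart_jacobian_linear compatible_charts_at charts_atD)
  show ?thesis
  proof (rule subspaceI)
    show "0 \<in> tangent_space M p"
      by (auto simp: tangent_space_iff linear_0[OF lin])
    fix v assume v: "v \<in> tangent_space M p"
    have v': "component v d = chart_jacobian c d p (component v c)"
      if "c \<in> charts_at M p" "d \<in> charts_at M p" for c d
      using v that unfolding tangent_space_iff by blast
    show "r *\<^sub>R v \<in> tangent_space M p" for r
      using v by (auto simp: tangent_space_iff linear_cmul[OF lin] simp flip: v')
    fix u assume u: "u \<in> tangent_space M p"
    have u': "component u d = chart_jacobian c d p (component u c)"
      if "c \<in> charts_at M p" "d \<in> charts_at M p" for c d
      using u that unfolding tangent_space_iff by blast
    have "component (v + u) c = 0" if "c \<notin> charts_at M p" for c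
    proof -
      have "component u c = 0" "component v c = 0" using u v that unfolding tangent_space_iff by blast+
      then show ?thesis by simp
    qed
    then show "v + u \<in> tangent_space M p"
      unfolding tangent_space_iff component_simps
      by (auto simp: linear_add[OF lin] simp flip: v' u')
  qed
qed

lemma coord_field_in_tangent_space:
  assumes "smooth_manifold m M" "c \<in> charts_at M p"
  shows "coord_field M c u p \<in> tangent_space M p"
  unfolding tangent_space_iff component_coord_field
  using chart_jacobian_compose_charts_at[OF assms] by simp

text \<open>Together with \<open>component_coord_field_self\<close> this identifies the tangent
  space with the model space through any one chart; forms are read off in coordinates by means of
  this identification.\<close>

lemma coord_field_of_component:
  assumes "v \<in> tangent_space M p" "c \<in> charts_at M p"
  shows "coord_field M c (component v c) p = v"
proof (rule tvec_eqI)
  fix d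
  show "component (coord_field M c (component v c) p) d = component v d"
  proof (cases "d \<in> charts_at M p")
    case True
    then have "component v d = chart_jacobian c d p (component v c)"
      using assms unfolding tangent_space_iff by blast
    with True show ?thesis unfolding component_coord_field by (simp only: if_True)
  next
    case False
    then have "component v d = 0" using assms unfolding tangent_space_iff by blast
    with False show ?thesis by (simp add: component_coord_field)
  qed
qed

lemma coord_field_linear:
  assumes "smooth_manifold m M" "c \<in> charts_at M p"
  shows "linear (\<lambda>u. coord_field M c u p)"
proof -
  have "linear (chart_jacobian c d p)" if "d \<in> charts_at M p" for d
    using that assms by (simp add: chart_jacobian_linear compatible_charts_at charts_atD)
  then show ?thesis
    by (intro linearI tvec_eqI) (auto simp: component_coord_field linear_add linear_cmul)
qed

lemma component_linear: "linear (\<lambda>u. component u c)"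
  by (intro linearI) auto

subsection \<open>Extension of tangent vectors to vector fields\<close>

text \<open>Multiply the constant coordinate field by a bump function and extend by zero. For
  smoothness at the boundary of the chart domain, the set \<open>K\<close> outside which the field
  vanishes has to be closed in all of \<open>N\<close> and not only in the domain; this is where the
  Hausdorff axiom enters.\<close>

lemma vector_field_extension:
  fixes N :: "('a, 'e::euclidean_space) manifold"
  assumes N: "smooth_manifold n N" and d: "d \<in> charts_at N p"
  obtains X where "vector_field N X" "X p = coord_field N d a p"
proof -
  have dA: "d \<in> atlas N" and pd: "p \<in> fst d" using d by (auto simp: charts_at_def)
  note d_chart = chart_properties[OF N dA]
  obtain r where r: "r > 0" "cball (snd d p) r \<subseteq> snd d ` fst d"
    using d_chart(2) pd open_contains_cball by (metis image_eqI)
  obtain \<rho> :: "'e \<Rightarrow> real" where \<rho>: "smooth_on UNIV \<rho>" "\<rho> (snd d p) = 1"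
    "\<And>y. y \<notin> cball (snd d p) r \<Longrightarrow> \<rho> y = 0"
    using bump_function[OF r(1), of "snd d p"] by blast
  define K where "K = chart_inv d ` cball (snd d p) r"
  have "closedin (mtop N) K"
  proof (rule compactin_imp_closedin)
    show "Hausdorff_space (mtop N)" using N by (simp add: smooth_manifold_def)
    have ts: "topspace (subtopology (mtop N) (fst d)) = fst d"
      using d_chart(3) by (auto simp: carrier_def)
    obtain g where g: "homeomorphic_maps (subtopology (mtop N) (fst d)) (top_of_set (snd d ` fst d)) (snd d) g"
      using d_chart(4) homeomorphic_map_maps by blast
    \<comment> \<open>\<open>chart_inv d\<close> is a mere choice of preimages. Identifying it with
      the topological inverse \<open>g\<close> yields the continuity by which \<open>K\<close> is
      compact.\<close>
    have "g y = chart_inv d y" if "y \<in> snd d ` fst d" for y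
      using g that ts d_chart(5) chart_inv_snd by (fastforce simp: homeomorphic_maps_def)
    then have "K = g ` cball (snd d p) r" using r(2) by (force simp: K_def)
    moreover have "compactin (top_of_set (snd d ` fst d)) (cball (snd d p) r)"
      using r(2) by (simp add: compactin_subtopology)
    ultimately have "compactin (subtopology (mtop N) (fst d)) K"
      using g image_compactin by (auto simp: homeomorphic_maps_def)
    then show "compactin (mtop N) K" by (simp add: compactin_subtopology)
  qed
  then have K_open: "openin (mtop N) (topspace (mtop N) - K)" by blast
  define X where "X q = (if q \<in> fst d then coord_field N d (\<rho> (snd d q) *\<^sub>R a) q else 0)" for q
  have X_outside: "X q = 0" if "q \<notin> K" for q
  proof (cases "q \<in> fst d")
    case True
    then have "snd d q \<notin> cball (snd d p) r"
      using that chart_inv_snd[OF d_chart(5) True] by (force simp: K_def)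
    moreover have "d \<in> charts_at N q"
      using True dA by (simp add: charts_at_def)
    ultimately show ?thesis
      using True \<rho>(3) linear_0[OF coord_field_linear[OF N, of d q]] by (simp add: X_def)
  qed (simp add: X_def)
  have K_fst: "K \<subseteq> fst d" using r(2) by (auto simp: K_def chart_inv_def intro: inv_into_into)
  have "vector_field N X"
    unfolding vector_field_def
  proof (intro conjI ballI allI impI)
    fix q assume "q \<in> carrier N"
    show "X q \<in> tangent_space N q"
      using coord_field_in_tangent_space[OF N] subspace_0[OF tangent_space_subspace[OF N]] dA
      by (auto simp: X_def charts_at_def)
  next
    fix q assume "q \<notin> carrier N"
    then show "X q = 0" using d_chart(3) by (auto simp: X_def)
  next
    fix c assume c: "c \<in> atlas N"
    have cd: "compatible c d" and dc: "compatible d c" using N c dA by (simp_all add: compatible_atlas)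
    show "smooth_on (snd c ` fst c) (\<lambda>x. component (X (chart_inv c x)) c)"
    proof (rule smooth_on_local)
      fix x assume "x \<in> snd c ` fst c"
      then obtain q where q: "q \<in> fst c" "x = snd c q" by blast
      \<comment> \<open>Two open sets suffice: on \<open>fst d\<close> the defining formula holds,
        and every other point lies in the complement of \<open>K\<close>, where the field
        vanishes.\<close>
      show "\<exists>U. open U \<and> x \<in> U \<and> smooth_on U (\<lambda>x. component (X (chart_inv c x)) c)"
      proof (cases "q \<in> fst d")
        case True
        let ?U = "snd c ` (fst c \<inter> fst d)" and ?T = "local_rep c d (\<lambda>p. p)"
        let ?V = "snd d ` (fst d \<inter> fst c)"
        have U: "open ?U" "smooth_on ?U ?T" "open ?V" using cd dc by (auto simp: compatible_def)
        have TU: "?T ` ?U \<subseteq> ?V" using cd by (auto simp: local_rep_ident)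
        have "smooth_on ?U (\<lambda>x. \<rho> (?T x) *\<^sub>R chart_jacobian d c (chart_inv d (?T x)) a)"
          by (rule smooth_on_scaleR[OF U(1) smooth_on_compose[OF U(1) open_UNIV _ \<rho>(1) U(2)]
                smooth_on_compose[OF U(1,3) TU chart_jacobian_smooth[OF dc] U(2)]]) simp
        then have "smooth_on ?U (\<lambda>x. component (X (chart_inv c x)) c)"
        proof (rule smooth_on_cong[OF U(1), rotated])
          fix x assume "x \<in> ?U"
          then obtain q where q: "q \<in> fst c" "q \<in> fst d" "x = snd c q" by blast
          then show "\<rho> (?T x) *\<^sub>R chart_jacobian d c (chart_inv d (?T x)) a = component (X (chart_inv c x)) c"
            using cd dc c by (simp add: X_def local_rep_ident component_coord_field charts_at_def
                chart_inv_snd compatible_def linear_cmul[OF chart_jacobian_linear[OF dc]])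
        qed
        then show ?thesis using U(1) q True by blast
      next
        case False
        let ?U = "snd c ` (fst c \<inter> (topspace (mtop N) - K))"
        have U: "open ?U" by (rule open_chart_image[OF N c K_open])
        have "smooth_on ?U (\<lambda>x. component (X (chart_inv c x)) c)"
          by (rule smooth_on_cong[OF U _ smooth_on_const[of _ 0]])
             (use cd in \<open>auto simp: compatible_def chart_inv_snd X_outside\<close>)
        moreover have "x \<in> ?U"
          using q False K_fst chart_properties(3)[OF N c] by (auto simp: carrier_def)
        ultimately show ?thesis using U by blast
      qed
    qed
  qed
  moreover have "X p = coord_field N d a p" using pd \<rho>(2) by (simp add: X_def)
  ultimately show ?thesis by (rule that)
qed

section \<open>The fundamental two-form of a cosymplectic manifold\<close>

lemma lin_onD:
  assumes "lin_on V f" "u \<in> V" "v \<in> V"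
  shows "f (a *\<^sub>R u + b *\<^sub>R v) = a *\<^sub>R f u + b *\<^sub>R f v"
  using assms unfolding lin_on_def by blast

lemma lin_on_simps:
  assumes "lin_on V f" "subspace V"
  shows "f 0 = 0" "u \<in> V \<Longrightarrow> f (r *\<^sub>R u) = r *\<^sub>R f u"
    "u \<in> V \<Longrightarrow> v \<in> V \<Longrightarrow> f (u - v) = f u - f v"
proof -
  show "f 0 = 0" using lin_onD[OF assms(1) subspace_0[OF assms(2)] subspace_0[OF assms(2)], of 0 0] by simp
  show "f (r *\<^sub>R u) = r *\<^sub>R f u" if "u \<in> V" using lin_onD[OF assms(1) that that, of r 0] by simp
  show "f (u - v) = f u - f v" if "u \<in> V" "v \<in> V" using lin_onD[OF assms(1) that, of 1 "-1"] by simp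
qed

lemma lin_on_comp_linear:
  assumes "lin_on V f" "linear L" "range L \<subseteq> V"
  shows "linear (\<lambda>u. f (L u))"
proof (rule linearI)
  have L: "L u \<in> V" for u using assms(3) by blast
  show "f (L (u + v)) = f (L u) + f (L v)" for u v
    using lin_onD[OF assms(1) L L, of 1 u 1 v] by (simp add: linear_add[OF assms(2)])
  show "f (L (r *\<^sub>R u)) = r *\<^sub>R f (L u)" for r u
    using lin_onD[OF assms(1) L L, of r u 0 u] by (simp add: linear_cmul[OF assms(2)])
qed

text \<open>Computing \<open>\<phi> (\<phi> (\<phi> u))\<close> in two ways gives \<open>\<eta>
  (\<phi> u) *\<^sub>R \<xi> = \<eta> u *\<^sub>R \<phi> \<xi>\<close>, whence first
  \<open>\<phi> \<xi> = 0\<close> and then \<open>\<eta> (\<phi> w) = 0\<close>. Compatibility of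
  the metric, applied to \<open>u\<close> and \<open>\<phi> v\<close>, then moves
  \<open>\<phi>\<close> to the other argument.\<close>

lemma almost_contact_skew:
  fixes \<phi> :: "'v::real_vector \<Rightarrow> 'v" and g :: "'v \<Rightarrow> 'v \<Rightarrow> real"
  assumes V: "subspace V" and \<phi>: "lin_on V \<phi>" "\<phi> ` V \<subseteq> V" and \<eta>: "lin_on V \<eta>" "\<eta> \<xi> = 1" and \<xi>: "\<xi> \<in> V"
    and g: "\<And>u. u \<in> V \<Longrightarrow> lin_on V (g u)" "\<And>u v. u \<in> V \<Longrightarrow> v \<in> V \<Longrightarrow> g u v = g v u"
    and \<phi>2: "\<And>u. u \<in> V \<Longrightarrow> \<phi> (\<phi> u) = - u + \<eta> u *\<^sub>R \<xi>"
    and g\<phi>: "\<And>u v. u \<in> V \<Longrightarrow> v \<in> V \<Longrightarrow> g (\<phi> u) (\<phi> v) = g u v - \<eta> u * \<eta> v"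
    and uv: "u \<in> V" "v \<in> V"
  shows "g u (\<phi> v) = - g v (\<phi> u)"
proof -
  have \<phi>V: "\<phi> u \<in> V" if "u \<in> V" for u using \<phi>(2) that by blast
  have \<xi>0: "\<xi> \<noteq> 0" using \<eta>(2) lin_on_simps(1)[OF \<eta>(1) V] by auto
  have \<phi>3: "\<phi> (\<phi> (\<phi> u)) = - \<phi> u + \<eta> u *\<^sub>R \<phi> \<xi>" if "u \<in> V" for u
    using lin_onD[OF \<phi>(1) that \<xi>, of "-1" "\<eta> u"] \<phi>2[OF that] by simp
  have \<phi>\<xi>: "\<phi> \<xi> = 0"
  proof -
    have "\<phi> \<xi> = \<eta> (\<phi> \<xi>) *\<^sub>R \<xi>"
      using \<phi>3[OF \<xi>] \<phi>2[OF \<phi>V[OF \<xi>]] \<eta>(2) by simp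
    \<comment> \<open>So the scalar \<open>\<eta> (\<phi> \<xi>)\<close> times
      \<open>\<phi> \<xi>\<close> is zero. Either factor being zero gives the claim, as
      \<open>\<phi> \<xi>\<close> is itself that scalar times \<open>\<xi>\<close>.\<close>
    moreover from this have "\<phi> (\<phi> \<xi>) = \<eta> (\<phi> \<xi>) *\<^sub>R \<phi> \<xi>"
      using lin_on_simps(2)[OF \<phi>(1) V \<xi>] by metis
    moreover have "\<phi> (\<phi> \<xi>) = 0" using \<phi>2[OF \<xi>] \<eta>(2) by simp
    ultimately show ?thesis by auto
  qed
  have \<eta>\<phi>: "\<eta> (\<phi> w) = 0" if "w \<in> V" for w
    using \<phi>3[OF that] \<phi>2[OF \<phi>V[OF that]] \<phi>\<xi> \<xi>0 by simp
  have g0: "g w 0 = 0" if "w \<in> V" for w using lin_on_simps(1)[OF g(1)[OF that] V] .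
  have g\<xi>: "g w \<xi> = \<eta> w" if "w \<in> V" for w
    using g\<phi>[OF that \<xi>] \<phi>\<xi> \<eta>(2) g0[OF \<phi>V[OF that]] by simp
  have "g u (\<phi> v) = g (\<phi> u) (\<phi> (\<phi> v))"
    using g\<phi>[OF uv(1) \<phi>V[OF uv(2)]] \<eta>\<phi>[OF uv(2)] by simp
  also have "\<dots> = - g (\<phi> u) v + \<eta> v * g (\<phi> u) \<xi>"
    using lin_onD[OF g(1)[OF \<phi>V[OF uv(1)]] uv(2) \<xi>, of "-1" "\<eta> v"] \<phi>2[OF uv(2)] by simp
  also have "\<dots> = - g v (\<phi> u)"
    using g\<xi>[OF \<phi>V[OF uv(1)]] \<eta>\<phi>[OF uv(1)] g(2)[OF \<phi>V[OF uv(1)] uv(2)] by simp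
  finally show ?thesis .
qed

lemma vector_field_in_tangent_space:
  "vector_field M X \<Longrightarrow> p \<in> carrier M \<Longrightarrow> X p \<in> tangent_space M p"
  by (simp add: vector_field_def)

section \<open>Forms and endomorphism fields in a chart\<close>

definition local_form ::
    "('a, 'e::real_normed_vector) manifold \<Rightarrow> ('a, 'e) chart \<Rightarrow>
     ('a \<Rightarrow> ('a, 'e) tvec \<Rightarrow> ('a, 'e) tvec \<Rightarrow> real) \<Rightarrow> 'e \<Rightarrow> 'e \<Rightarrow> 'e \<Rightarrow> real" where
  "local_form M c h x u v =
     h (chart_inv c x) (coord_field M c u (chart_inv c x)) (coord_field M c v (chart_inv c x))"

lemma local_form_bilinear:
  assumes "smooth_manifold m M" "c \<in> atlas M" "bilinear_field M h" "x \<in> snd c ` fst c"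
  shows "bilinear (local_form M c h x)"
proof -
  let ?q = "chart_inv c x"
  note q = chart_inv_charts_at[OF assms(1,2,4)]
  have lin: "linear (\<lambda>u. coord_field M c u ?q)" "range (\<lambda>u. coord_field M c u ?q) \<subseteq> tangent_space M ?q"
    using coord_field_linear[OF assms(1) q(1)] coord_field_in_tangent_space[OF assms(1) q(1)] by auto
  have h: "lin_on (tangent_space M ?q) (h ?q u)" "lin_on (tangent_space M ?q) (\<lambda>v. h ?q v u)"
    if "u \<in> tangent_space M ?q" for u
    using assms(3) q(3) that by (auto simp: bilinear_field_def)
  show ?thesis
    unfolding bilinear_def local_form_def
    using lin_on_comp_linear[OF h(1) lin] lin_on_comp_linear[OF h(2) lin] lin(2) by blast
qed

lemma local_form_smooth:
  "bilinear_field M h \<Longrightarrow> c \<in> atlas M \<Longrightarrow> smooth_on (snd c ` fst c) (\<lambda>x. local_form M c h x u v)"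
  unfolding bilinear_field_def local_form_def by blast

lemma local_form_component:
  assumes "smooth_manifold m M" "c \<in> charts_at M q" "u \<in> tangent_space M q" "v \<in> tangent_space M q"
  shows "local_form M c h (snd c q) (component u c) (component v c) = h q u v"
proof -
  have "c \<in> atlas M" "q \<in> fst c" using assms(2) by (auto simp: charts_at_def)
  then have "chart_inv c (snd c q) = q" using chart_properties(5)[OF assms(1)] by (simp add: chart_inv_snd)
  then show ?thesis using assms by (simp add: local_form_def coord_field_of_component)
qed

lemma smooth_on_bilinear_form:
  fixes h :: "'u::real_normed_vector \<Rightarrow> 'e::euclidean_space \<Rightarrow> 'e \<Rightarrow> real"
  assumes "open S" "\<And>x. x \<in> S \<Longrightarrow> bilinear (h x)" "\<And>u v. smooth_on S (\<lambda>x. h x u v)"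
    and "smooth_on S Y" "smooth_on S Z"
  shows "smooth_on S (\<lambda>x. h x (Y x) (Z x))"
proof -
  have "smooth_on S (\<lambda>x. \<Sum>i\<in>Basis. \<Sum>j\<in>Basis. (Y x \<bullet> i) *\<^sub>R ((Z x \<bullet> j) *\<^sub>R h x i j))"
    by (intro smooth_on_sum smooth_on_scaleR smooth_on_inner smooth_on_const assms)
  then show ?thesis
    by (rule smooth_on_cong[OF assms(1), rotated])
       (simp add: frame_bilinear[OF frame_Basis assms(2), of _ "Y _" "Z _"])
qed

text \<open>The definition of \<open>endo_field\<close> gives smoothness only on coordinate fields
  with a fixed argument; this expansion reduces an arbitrary tangent vector to them.\<close>

lemma endo_field_local:
  fixes N :: "('a, 'e::euclidean_space) manifold"
  assumes N: "smooth_manifold n N" and c: "c \<in> charts_at N q" and A: "endo_field N A"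
    and v: "v \<in> tangent_space N q"
  shows "component (A q v) c = (\<Sum>e\<in>Basis. (component v c \<bullet> e) *\<^sub>R component (A q (coord_field N c e q)) c)"
proof -
  have q: "q \<in> carrier N" by (rule chart_inv_charts_atD(2)[OF N c])
  have "linear (\<lambda>u. A q (coord_field N c u q))"
    by (rule lin_on_comp_linear[of "tangent_space N q"])
       (use A q coord_field_linear[OF N c] coord_field_in_tangent_space[OF N c] in \<open>auto simp: endo_field_def\<close>)
  then have "linear (\<lambda>u. component (A q (coord_field N c u q)) c)"
    using linear_compose[OF _ component_linear[of c]] by (simp add: comp_def)
  from linear_euclidean_sum[OF this, of "component v c"] show ?thesis
    by (simp add: coord_field_of_component[OF v c])
qed

lemma bilinear_field_compose_endo:
  fixes N :: "('a, 'e::euclidean_space) manifold"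
  assumes N: "smooth_manifold n N" and A: "endo_field N A" and g: "bilinear_field N g"
  shows "bilinear_field N (\<lambda>q u v. g q u (A q v))"
  unfolding bilinear_field_def
proof (intro conjI ballI allI)
  fix p u assume p: "p \<in> carrier N" and u: "u \<in> tangent_space N p"
  have A': "lin_on (tangent_space N p) (A p)" "A p ` tangent_space N p \<subseteq> tangent_space N p"
    using A p by (auto simp: endo_field_def)
  have g': "lin_on (tangent_space N p) (g p w)" "lin_on (tangent_space N p) (\<lambda>v. g p v w)"
    if "w \<in> tangent_space N p" for w
    using g p that by (auto simp: bilinear_field_def)
  show "lin_on (tangent_space N p) (\<lambda>v. g p u (A p v))"
    using A' g'(1)[OF u] unfolding lin_on_def by (simp add: image_subset_iff)
  show "lin_on (tangent_space N p) (\<lambda>v. g p v (A p u))"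
    using g'(2)[of "A p u"] A'(2) u by blast
next
  fix c and u v :: 'e assume c: "c \<in> atlas N"
  let ?S = "snd c ` fst c"
  let ?A = "\<lambda>x. component (A (chart_inv c x) (coord_field N c v (chart_inv c x))) c"
  have S: "open ?S" using chart_properties(2)[OF N c] .
  have "smooth_on ?S ?A" using A c by (simp add: endo_field_def)
  then have "smooth_on ?S (\<lambda>x. local_form N c g x u (?A x))"
    by (intro smooth_on_bilinear_form[where h = "local_form N c g" and Y = "\<lambda>x. u"] S
        local_form_bilinear[OF N c g] local_form_smooth[OF g c] smooth_on_const)
  then show "smooth_on ?S (\<lambda>x. g (chart_inv c x) (coord_field N c u (chart_inv c x))
      (A (chart_inv c x) (coord_field N c v (chart_inv c x))))"
  proof (rule smooth_on_cong[OF S, rotated])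
    fix x assume x: "x \<in> ?S"
    note q = chart_inv_charts_at[OF N c x]
    have "A (chart_inv c x) (coord_field N c v (chart_inv c x)) \<in> tangent_space N (chart_inv c x)"
      using A q(3) coord_field_in_tangent_space[OF N q(1)] by (auto simp: endo_field_def)
    then show "local_form N c g x u (?A x) = g (chart_inv c x) (coord_field N c u (chart_inv c x))
      (A (chart_inv c x) (coord_field N c v (chart_inv c x)))"
      by (simp add: local_form_def coord_field_of_component q(1))
  qed
qed

lemma vector_field_endo:
  fixes N :: "('a, 'e::euclidean_space) manifold"
  assumes N: "smooth_manifold n N" and A: "endo_field N A" and Z: "vector_field N Z"
  shows "vector_field N (\<lambda>q. A q (Z q))"
  unfolding vector_field_def
proof (intro conjI ballI allI impI)
  fix p assume "p \<in> carrier N"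
  then show "A p (Z p) \<in> tangent_space N p"
    using A vector_field_in_tangent_space[OF Z] by (auto simp: endo_field_def)
next
  fix p assume "p \<notin> carrier N"
  then show "A p (Z p) = 0" using A by (simp add: endo_field_def)
next
  fix c assume c: "c \<in> atlas N"
  let ?S = "snd c ` fst c"
  have S: "open ?S" using chart_properties(2)[OF N c] .
  have "smooth_on ?S (\<lambda>x. component (Z (chart_inv c x)) c)" using Z c by (simp add: vector_field_def)
  moreover have "smooth_on ?S (\<lambda>x. component (A (chart_inv c x) (coord_field N c e (chart_inv c x))) c)" for e
    using A c by (simp add: endo_field_def)
  ultimately have "smooth_on ?S (\<lambda>x. \<Sum>e\<in>Basis. (component (Z (chart_inv c x)) c \<bullet> e) *\<^sub>R
      component (A (chart_inv c x) (coord_field N c e (chart_inv c x))) c)"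
    by (intro smooth_on_sum smooth_on_scaleR smooth_on_inner smooth_on_const S)
  then show "smooth_on ?S (\<lambda>x. component (A (chart_inv c x) (Z (chart_inv c x))) c)"
  proof (rule smooth_on_cong[OF S, rotated])
    fix x assume x: "x \<in> ?S"
    note q = chart_inv_charts_at[OF N c x]
    show "(\<Sum>e\<in>Basis. (component (Z (chart_inv c x)) c \<bullet> e) *\<^sub>R
        component (A (chart_inv c x) (coord_field N c e (chart_inv c x))) c)
      = component (A (chart_inv c x) (Z (chart_inv c x))) c"
      by (rule endo_field_local[OF N q(1) A vector_field_in_tangent_space[OF Z q(3)], symmetric])
  qed
qed

subsection \<open>The exterior derivative in coordinates\<close>

text \<open>The exterior derivative of \<open>h\<close> on the constant fields \<open>u\<close>,
  \<open>v\<close>, \<open>w\<close> of the model space: their brackets vanish, and only the three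
  derivative terms remain.\<close>

definition coord_ext_deriv ::
    "('u::real_normed_vector \<Rightarrow> 'u \<Rightarrow> 'u \<Rightarrow> real) \<Rightarrow> 'u \<Rightarrow> 'u \<Rightarrow> 'u \<Rightarrow> 'u \<Rightarrow> real" where
  "coord_ext_deriv h x u v w =
     frechet_derivative (\<lambda>y. h y v w) (at x) u
   - frechet_derivative (\<lambda>y. h y u w) (at x) v
   + frechet_derivative (\<lambda>y. h y u v) (at x) w"

text \<open>Differentiating the components of the fields produces the same terms as expanding the
  brackets, so only the values of the fields at \<open>p\<close> survive. The form is represented by
  an abstract \<open>h\<close> on a neighbourhood \<open>U\<close>, to serve both for the ambient
  manifold and for a pullback that lives on the overlap of two charts. The bracket terms are a
  separate hypothesis \<open>lie\<close>, because the second assumption speaks of tangent vectors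
  and a bracket is not yet known to be one. The chart is the one that \<open>dir_deriv\<close>
  selects.\<close>

lemma ext_deriv_in_chart:
  fixes M :: "('a, 'u::real_normed_vector) manifold" and b :: "'i \<Rightarrow> 'u"
  assumes fr: "frame I b l" and M: "smooth_manifold m M" and p: "p \<in> carrier M"
    and c: "c = (SOME c. c \<in> charts_at M p)"
    and U: "open U" "snd c p \<in> U" "U \<subseteq> snd c ` fst c"
    and \<omega>: "\<And>x u v. x \<in> U \<Longrightarrow> u \<in> tangent_space M (chart_inv c x) \<Longrightarrow> v \<in> tangent_space M (chart_inv c x) \<Longrightarrow>
      \<omega> (chart_inv c x) u v = h x (component u c) (component v c)"
    and lie: "\<And>X Y Z. vector_field M X \<Longrightarrow> vector_field M Y \<Longrightarrow> vector_field M Z \<Longrightarrow>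
      \<omega> p (lie_bracket M X Y p) (Z p)
        = h (snd c p) (component (lie_bracket M X Y p) c) (component (Z p) c)"
    and h: "\<And>x. x \<in> U \<Longrightarrow> bilinear (h x)" "\<And>u v. (\<lambda>x. h x u v) differentiable (at (snd c p))"
      "\<And>u v. h (snd c p) u v = - h (snd c p) v u"
    and X: "vector_field M X" and Y: "vector_field M Y" and Z: "vector_field M Z"
  shows "ext_deriv M \<omega> X Y Z p
    = coord_ext_deriv h (snd c p) (component (X p) c) (component (Y p) c) (component (Z p) c)"
proof -
  define x0 where "x0 = snd c p"
  have cp: "c \<in> charts_at M p" unfolding c by (rule some_chart_at[OF M p])
  have cA: "c \<in> atlas M" and pc: "p \<in> fst c" using cp by (auto simp: charts_at_def)
  have inv: "chart_inv c x0 = p"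
    unfolding x0_def using chart_properties(5)[OF M cA] pc by (rule chart_inv_snd)
  define D where "D Y = frechet_derivative (\<lambda>x. component (Y (chart_inv c x)) c) (at x0)"
    for Y :: "'a \<Rightarrow> ('a, 'u) tvec"
  have x0: "x0 \<in> snd c ` fst c" using pc by (simp add: x0_def)
  have D: "((\<lambda>x. component (Y (chart_inv c x)) c) has_derivative D Y) (at x0)" if "vector_field M Y" for Y
  proof -
    have "smooth_on (snd c ` fst c) (\<lambda>x. component (Y (chart_inv c x)) c)"
      using that cA by (simp add: vector_field_def)
    from smooth_on_differentiable[OF this x0] show ?thesis
      unfolding D_def by (simp flip: frechet_derivative_works)
  qed
  have dir: "dir_deriv M p v (\<lambda>q. \<omega> q (Y q) (Z q))
      = frechet_derivative (\<lambda>x. h x (component (Y p) c) (component (Z p) c)) (at x0) (component v c)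
        + h x0 (D Y (component v c)) (component (Z p) c) + h x0 (component (Y p) c) (D Z (component v c))"
    if Y: "vector_field M Y" and Z: "vector_field M Z" for v Y Z
  proof -
    let ?Y = "\<lambda>x. component (Y (chart_inv c x)) c" and ?Z = "\<lambda>x. component (Z (chart_inv c x)) c"
    have "((\<lambda>x. h x (?Y x) (?Z x)) has_derivative
       (\<lambda>w. frechet_derivative (\<lambda>x. h x (?Y x0) (?Z x0)) (at x0) w + h x0 (D Y w) (?Z x0) + h x0 (?Y x0) (D Z w)))
       (at x0)"
      by (rule bilinear_field_has_derivative[OF fr U(1) _ h(1)])
         (use U(2) h(2) D Y Z in \<open>auto simp: x0_def\<close>)
    then have "((\<lambda>x. \<omega> (chart_inv c x) (Y (chart_inv c x)) (Z (chart_inv c x))) has_derivative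
       (\<lambda>w. frechet_derivative (\<lambda>x. h x (?Y x0) (?Z x0)) (at x0) w + h x0 (D Y w) (?Z x0) + h x0 (?Y x0) (D Z w)))
       (at x0)"
    proof (rule has_derivative_transform_within_open[OF _ U(1)])
      show "x0 \<in> U" using U(2) by (simp add: x0_def)
      fix x assume x: "x \<in> U"
      then have "chart_inv c x \<in> carrier M" using chart_inv_charts_at(3)[OF M cA] U(3) by blast
      then show "h x (?Y x) (?Z x) = \<omega> (chart_inv c x) (Y (chart_inv c x)) (Z (chart_inv c x))"
        using \<omega>[OF x] vector_field_in_tangent_space Y Z by metis
    qed
    then show ?thesis
      unfolding dir_deriv_def Let_def c[symmetric] x0_def[symmetric]
      by (simp add: frechet_derivative_eq inv)
  qed
  have br: "component (lie_bracket M X Y p) c = D Y (component (X p) c) - D X (component (Y p) c)" for X Y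
    using cp by (simp add: lie_bracket_def D_def x0_def)
  have bil: "bilinear (h x0)" using h(1) U(2) by (simp add: x0_def)
  have anti: "h x0 u v = - h x0 v u" for u v unfolding x0_def by (rule h(3))
  show ?thesis
    unfolding ext_deriv_def coord_ext_deriv_def dir[OF Y Z] dir[OF X Z] dir[OF X Y]
      lie[OF X Y Z] lie[OF X Z Y] lie[OF Y Z X] br x0_def[symmetric] bilinear_lsub[OF bil]
    \<comment> \<open>Of the six terms with derivatives of components, three cancel directly against
      the brackets. In the other three the derivative stands in the second slot and has to be moved
      to the first.\<close>
    using anti[of "component (X p) c" "D Z (component (Y p) c)"]
      anti[of "component (X p) c" "D Y (component (Z p) c)"]
      anti[of "component (Y p) c" "D Z (component (X p) c)"]
    by simp
qed

subsection \<open>Closedness\<close>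

lemma levi_civitaD:
  assumes "levi_civita N g D" "vector_field N X" "vector_field N Y"
  shows "vector_field N (D X Y)"
    "p \<in> carrier N \<Longrightarrow> lie_bracket N X Y p = D X Y p - D Y X p"
    "vector_field N Z \<Longrightarrow> p \<in> carrier N \<Longrightarrow>
       dir_deriv N p (X p) (\<lambda>q. g q (Y q) (Z q)) = g p (D X Y p) (Z p) + g p (Y p) (D X Z p)"
  using assms unfolding levi_civita_def affine_connection_def by metis+

text \<open>Metric compatibility is applied to \<open>Y\<close> and the field \<open>A Z\<close>;
  since \<open>A\<close> is parallel, the derivative of \<open>A Z\<close> is \<open>A\<close> of
  the derivative of \<open>Z\<close>, so the form itself is parallel. Torsion-freeness rewrites the
  brackets, and the terms then match as in coordinates, with covariant derivatives in place of
  derivatives of components.\<close>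

lemma parallel_two_form_closed:
  fixes N :: "('a, 'e::euclidean_space) manifold"
  assumes N: "smooth_manifold n N" and A: "endo_field N A" and g: "bilinear_field N g"
    and D: "levi_civita N g D"
    and par: "\<And>X Y p. vector_field N X \<Longrightarrow> vector_field N Y \<Longrightarrow> p \<in> carrier N \<Longrightarrow> cov_deriv_endo D A X Y p = 0"
    and skew: "\<And>p u v. p \<in> carrier N \<Longrightarrow> u \<in> tangent_space N p \<Longrightarrow> v \<in> tangent_space N p \<Longrightarrow>
      g p u (A p v) = - g p v (A p u)"
    and X: "vector_field N X" and Y: "vector_field N Y" and Z: "vector_field N Z" and p: "p \<in> carrier N"
  shows "ext_deriv N (\<lambda>q u v. g q u (A q v)) X Y Z p = 0"
proof -
  let ?\<omega> = "\<lambda>u v. g p u (A p v)"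
  have T: "X p \<in> tangent_space N p" if "vector_field N X" for X
    using vector_field_in_tangent_space[OF that p] .
  have dir: "dir_deriv N p (X p) (\<lambda>q. g q (Y q) (A q (Z q))) = ?\<omega> (D X Y p) (Z p) + ?\<omega> (Y p) (D X Z p)"
    if "vector_field N X" "vector_field N Y" "vector_field N Z" for X Y Z
    using levi_civitaD(3)[OF D that(1,2) vector_field_endo[OF N A that(3)] p] par[OF that(1,3) p]
    by (simp add: cov_deriv_endo_def)
  have lie: "?\<omega> (lie_bracket N X Y p) (Z p) = ?\<omega> (D X Y p) (Z p) - ?\<omega> (D Y X p) (Z p)"
    if XYZ: "vector_field N X" "vector_field N Y" "vector_field N Z" for X Y Z
  proof -
    have "A p (Z p) \<in> tangent_space N p" using vector_field_in_tangent_space[OF vector_field_endo[OF N A XYZ(3)] p] .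
    then have "lin_on (tangent_space N p) (\<lambda>v. g p v (A p (Z p)))" using g p by (simp add: bilinear_field_def)
    from lin_on_simps(3)[OF this tangent_space_subspace[OF N] T T]
    show ?thesis using levi_civitaD(1,2)[OF D] XYZ p by simp
  qed
  show ?thesis
    unfolding ext_deriv_def dir[OF X Y Z] dir[OF Y X Z] dir[OF Z X Y] lie[OF X Y Z] lie[OF X Z Y] lie[OF Y Z X]
    using skew[OF p T[OF X] T[OF levi_civitaD(1)[OF D Y Z]]] skew[OF p T[OF X] T[OF levi_civitaD(1)[OF D Z Y]]]
      skew[OF p T[OF Y] T[OF levi_civitaD(1)[OF D X Z]]]
    by simp
qed

text \<open>The coordinate vectors are realised as values of global fields. How these continue away
  from \<open>p\<close> is irrelevant, since the coordinate expression sees only their values at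
  \<open>p\<close>.\<close>

lemma closed_form_coord_ext_deriv:
  fixes N :: "('a, 'e::euclidean_space) manifold"
  assumes N: "smooth_manifold n N" and \<omega>: "bilinear_field N \<omega>"
    and skew: "\<And>p u v. p \<in> carrier N \<Longrightarrow> u \<in> tangent_space N p \<Longrightarrow> v \<in> tangent_space N p \<Longrightarrow> \<omega> p u v = - \<omega> p v u"
    and closed: "closed_form N \<omega>"
    and lie: "\<And>X Y p. vector_field N X \<Longrightarrow> vector_field N Y \<Longrightarrow> p \<in> carrier N \<Longrightarrow>
      lie_bracket N X Y p \<in> tangent_space N p"
    and p: "p \<in> carrier N" and d: "d = (SOME d. d \<in> charts_at N p)"
  shows "coord_ext_deriv (local_form N d \<omega>) (snd d p) a b c = 0"
proof -
  have dp: "d \<in> charts_at N p" unfolding d by (rule some_chart_at[OF N p])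
  have dA: "d \<in> atlas N" and pd: "p \<in> fst d" using dp by (auto simp: charts_at_def)
  obtain X where X: "vector_field N X" "X p = coord_field N d a p" using vector_field_extension[OF N dp] .
  obtain Y where Y: "vector_field N Y" "Y p = coord_field N d b p" using vector_field_extension[OF N dp] .
  obtain Z where Z: "vector_field N Z" "Z p = coord_field N d c p" using vector_field_extension[OF N dp] .
  have inv: "chart_inv d (snd d p) = p" by (rule chart_inv_charts_atD(1)[OF N dp])
  have "ext_deriv N \<omega> X Y Z p
    = coord_ext_deriv (local_form N d \<omega>) (snd d p) (component (X p) d) (component (Y p) d) (component (Z p) d)"
  proof (rule ext_deriv_in_chart[OF frame_Basis N p d chart_properties(2)[OF N dA]])
    show "snd d p \<in> snd d ` fst d" using pd by simp
    show "\<omega> (chart_inv d x) u v = local_form N d \<omega> x (component u d) (component v d)"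
      if x: "x \<in> snd d ` fst d"
        and uv: "u \<in> tangent_space N (chart_inv d x)" "v \<in> tangent_space N (chart_inv d x)" for x u v
      using local_form_component[OF N chart_inv_charts_at(1)[OF N dA x] uv]
        chart_inv_charts_at(2)[OF N dA x] by simp
    show "\<omega> p (lie_bracket N X Y p) (Z p)
        = local_form N d \<omega> (snd d p) (component (lie_bracket N X Y p) d) (component (Z p) d)"
      if "vector_field N X" "vector_field N Y" "vector_field N Z" for X Y Z
      using local_form_component[OF N dp lie vector_field_in_tangent_space] that p by simp
    show "bilinear (local_form N d \<omega> x)" if "x \<in> snd d ` fst d" for x
      by (rule local_form_bilinear[OF N dA \<omega> that])
    show "(\<lambda>x. local_form N d \<omega> x u v) differentiable (at (snd d p))" for u v
      using smooth_on_differentiable[OF local_form_smooth[OF \<omega> dA]] pd by blast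
    show "local_form N d \<omega> (snd d p) u v = - local_form N d \<omega> (snd d p) v u" for u v
      unfolding local_form_def inv by (intro skew p coord_field_in_tangent_space[OF N dp])
  qed (use X Y Z in auto)
  then show ?thesis
    using closed X Y Z p by (simp add: closed_form_def component_coord_field_self[OF N dp])
qed

section \<open>Pullback to a submanifold\<close>

text \<open>Gram-Schmidt, one generator at a time: subtract from \<open>b\<close> its projection
  onto \<open>span B\<close>, then project \<open>a\<close> onto the remaining direction. The
  induction is for arbitrary \<open>a\<close> because its hypothesis serves both \<open>a\<close>
  and \<open>b\<close>.\<close>

lemma orthogonal_projection_span:
  fixes h :: "'v::real_vector \<Rightarrow> 'v \<Rightarrow> real"
  assumes "finite B" and h: "bilinear h" "\<And>u v. h u v = h v u" "\<And>u. u \<noteq> 0 \<Longrightarrow> 0 < h u u"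
  shows "\<exists>t\<in>span B. \<forall>w\<in>span B. h (a - t) w = 0"
  using assms(1)
proof (induction B arbitrary: a)
  case empty
  then show ?case by (simp add: bilinear_rzero[OF h(1)])
next
  case (insert b B)
  obtain t where t: "t \<in> span B" "\<And>w. w \<in> span B \<Longrightarrow> h (a - t) w = 0"
    using insert.IH[of a] by blast
  obtain s where s: "s \<in> span B" "\<And>w. w \<in> span B \<Longrightarrow> h (b - s) w = 0"
    using insert.IH[of b] by blast
  note bil = bilinear_ladd[OF h(1)] bilinear_lsub[OF h(1)] bilinear_lmul[OF h(1)]
    bilinear_radd[OF h(1)] bilinear_rmul[OF h(1)]
  show ?case
  proof (cases "b = s")
    case True
    then have "span (insert b B) = span B" using s(1) by (simp add: span_redundant)
    then show ?thesis using t by auto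
  next
    case False
    define b' where "b' = b - s"
    have b': "0 < h b' b'" using h(3) False by (simp add: b'_def)
    \<comment> \<open>The coefficient of \<open>a\<close> along \<open>b'\<close>. Taking
      \<open>a\<close> or \<open>a - t\<close> makes no difference, as \<open>t\<close> is
      orthogonal to \<open>b'\<close>.\<close>
    define k where "k = h a b' / h b' b'"
    have sB: "s \<in> span (insert b B)" "t \<in> span (insert b B)" "b \<in> span (insert b B)"
      using s(1) t(1) span_mono[of B "insert b B"] by (auto intro: span_base)
    have "t + k *\<^sub>R b' \<in> span (insert b B)"
      unfolding b'_def using sB by (intro span_add span_scale span_diff)
    moreover have "h (a - (t + k *\<^sub>R b')) w = 0" if w: "w \<in> span (insert b B)" for w
    proof -
      obtain r where "w - r *\<^sub>R b \<in> span B" using w by (auto simp: span_breakdown_eq)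
      then have w': "w - r *\<^sub>R b + r *\<^sub>R s \<in> span B" using s(1) by (intro span_add span_scale)
      define w' where "w' = w - r *\<^sub>R b + r *\<^sub>R s"
      have w_eq: "w = w' + r *\<^sub>R b'" by (simp add: w'_def b'_def scaleR_diff_right)
      have 1: "h (a - t) w' = 0" "h b' w' = 0" "h t b' = 0"
        using t s(2) w' h(2)[of t b'] by (auto simp: w'_def b'_def)
      have 2: "a - (t + k *\<^sub>R b') = (a - t) - k *\<^sub>R b'" by simp
      have "h (a - t) b' = h a b'" using 1(3) by (simp add: bil)
      then have "h ((a - t) - k *\<^sub>R b') b' = 0"
        using b' by (simp only: bil) (simp add: k_def)
      moreover have "h ((a - t) - k *\<^sub>R b') w' = 0" using 1 by (simp only: bil) simp
      ultimately show ?thesis unfolding 2 w_eq bilinear_radd[OF h(1)] bilinear_rmul[OF h(1)] by simp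
    qed
    ultimately show ?thesis by blast
  qed
qed

lemma riemannian_metricD:
  assumes "riemannian_metric N g" "p \<in> carrier N"
  shows "u \<in> tangent_space N p \<Longrightarrow> lin_on (tangent_space N p) (g p u)"
    "u \<in> tangent_space N p \<Longrightarrow> v \<in> tangent_space N p \<Longrightarrow> g p u v = g p v u"
    "u \<in> tangent_space N p \<Longrightarrow> u \<noteq> 0 \<Longrightarrow> 0 < g p u u"
  using assms by (auto simp: riemannian_metric_def bilinear_field_def)

section \<open>Tangent space and differential of the inclusion in coordinates\<close>

lemma tangent_eq_range:
  assumes "smooth_manifold m M" "c \<in> charts_at M p"
  shows "tangent_space M p = range (\<lambda>u. coord_field M c u p)"
proof (intro equalityI subsetI)
  fix v assume "v \<in> tangent_space M p"
  then show "v \<in> range (\<lambda>u. coord_field M c u p)"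
    using coord_field_of_component assms(2) by (metis rangeI)
qed (use coord_field_in_tangent_space[OF assms] in auto)

text \<open>The vector need not be tangent: \<^term>\<open>differential\<close> only reads the component in the chosen
  chart. This spares a proof that Lie brackets on the submanifold transform as tangent vectors.\<close>

lemma differential_inclusion_some_chart:
  assumes M: "smooth_manifold m M" and N: "smooth_manifold n N" and i: "smooth_map M N (\<lambda>p. p)"
    and p: "p \<in> carrier M" and d: "d \<in> charts_at N p" and c: "c = (SOME c. c \<in> charts_at M p)"
  shows "differential M N (\<lambda>p. p) p v = coord_field N d (chart_jacobian c d p (component v c)) p"
proof (rule tvec_eqI)
  fix e
  have cp: "c \<in> charts_at M p" unfolding c by (rule some_chart_at[OF M p])
  have "chart_jacobian d e p (chart_jacobian c d p (component v c)) = chart_jacobian c e p (component v c)"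
    if e: "e \<in> charts_at N p"
    using compatible_submanifold[OF M N i] charts_atD[OF cp] charts_atD[OF d] charts_atD[OF e]
      compatible_atlas[OF N] by (intro chart_jacobian_compose) auto
  then show "component (differential M N (\<lambda>p. p) p v) e
      = component (coord_field N d (chart_jacobian c d p (component v c)) p) e"
    by (simp add: differential_def c[symmetric] component_coord_field chart_jacobian_def)
qed

lemma differential_inclusion:
  assumes M: "smooth_manifold m M" and N: "smooth_manifold n N" and i: "smooth_map M N (\<lambda>p. p)"
    and p: "p \<in> carrier M" and d: "d \<in> charts_at N p" and c: "c \<in> charts_at M p"
    and v: "v \<in> tangent_space M p"
  shows "differential M N (\<lambda>p. p) p v = coord_field N d (chart_jacobian c d p (component v c)) p"
proof -
  define c0 where "c0 = (SOME c. c \<in> charts_at M p)"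
  have c0: "c0 \<in> charts_at M p" unfolding c0_def by (rule some_chart_at[OF M p])
  have "component v c0 = chart_jacobian c c0 p (component v c)"
    using v c c0 unfolding tangent_space_iff by blast
  moreover have "chart_jacobian c0 d p (chart_jacobian c c0 p (component v c)) = chart_jacobian c d p (component v c)"
    using compatible_submanifold[OF M N i] charts_atD[OF c] charts_atD[OF d] charts_atD[OF c0]
      compatible_atlas[OF M] by (intro chart_jacobian_compose) auto
  ultimately show ?thesis
    using differential_inclusion_some_chart[OF M N i p d c0_def, of v] by simp
qed

lemma sub_tangent_eq_range:
  assumes M: "smooth_manifold m M" and N: "smooth_manifold n N" and i: "smooth_map M N (\<lambda>p. p)"
    and p: "p \<in> carrier M" and d: "d \<in> charts_at N p" and c: "c \<in> charts_at M p"
  shows "sub_tangent M N p = (\<lambda>a. coord_field N d a p) ` range (chart_jacobian c d p)"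
proof -
  have "differential M N (\<lambda>p. p) p (coord_field M c u p) = coord_field N d (chart_jacobian c d p u) p" for u
    using differential_inclusion[OF M N i p d c coord_field_in_tangent_space[OF M c]]
    by (simp add: component_coord_field_self[OF M c])
  then show ?thesis
    unfolding sub_tangent_def tangent_eq_range[OF M c] by (simp add: image_image)
qed

text \<open>This gives the description in \<open>tangential_part\<close> its meaning. For existence
  everything is carried to the model space of \<open>N\<close>, where the metric becomes a form on a
  whole vector space and the tangent space of \<open>M\<close> becomes the range of the Jacobian;
  the projection lemma then applies to a finite basis of that range.\<close>

lemma orthogonal_decomposition:
  fixes N :: "('a, 'e::euclidean_space) manifold"
  assumes M: "smooth_manifold m M" and N: "smooth_manifold n N" and i: "smooth_map M N (\<lambda>p. p)"
    and g: "riemannian_metric N g" and p: "p \<in> carrier M" "p \<in> carrier N" and v: "v \<in> tangent_space N p"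
  shows "\<exists>!t. t \<in> sub_tangent M N p \<and> (\<exists>w\<in>sub_normal M N g p. v = t + w)"
proof -
  let ?V = "tangent_space N p"
  obtain c d where c: "c \<in> charts_at M p" and d: "d \<in> charts_at N p"
    using some_chart_at[OF M p(1)] some_chart_at[OF N p(2)] by blast
  note W = sub_tangent_eq_range[OF M N i p(1) d c]
  define C where "C a = coord_field N d a p" for a
  have C: "linear C" "C a \<in> ?V" "component (C a) d = a" for a
    unfolding C_def using coord_field_linear[OF N d] coord_field_in_tangent_space[OF N d]
      component_coord_field_self[OF N d] by auto
  have V: "subspace ?V" by (rule tangent_space_subspace[OF N])
  note g' = riemannian_metricD[OF g p(2)]
  have J: "linear (chart_jacobian c d p)"
    using compatible_submanifold[OF M N i] charts_atD[OF c] charts_atD[OF d] by (intro chart_jacobian_linear) auto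
  have W_sub: "subspace (range (chart_jacobian c d p))" by (rule linear_subspace_image[OF J subspace_UNIV])
  have W_V: "sub_tangent M N p \<subseteq> ?V" and W_subspace: "subspace (sub_tangent M N p)"
    unfolding W using C linear_subspace_image[OF C(1) W_sub] by (auto simp: C_def)
  obtain B where B: "B \<subseteq> range (chart_jacobian c d p)" "independent B" "range (chart_jacobian c d p) \<subseteq> span B"
    using maximal_independent_subset by blast
  have span_B: "span B = range (chart_jacobian c d p)"
    using B span_minimal[OF B(1) W_sub] by blast
  let ?h = "\<lambda>a b. g p (C a) (C b)"
  have sym: "?h a b = ?h b a" for a b using g'(2) C(2) by blast
  have "linear (?h a)" for a
    using lin_on_comp_linear[OF g'(1)[OF C(2)] C(1)] C(2) by blast
  moreover from this have "linear (\<lambda>a. ?h a b)" for b unfolding sym[of _ b] .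
  ultimately have "bilinear ?h" by (simp add: bilinear_def)
  moreover have "0 < ?h a a" if "a \<noteq> 0" for a
  proof -
    have "C a \<noteq> 0" using C(3)[of a] that by auto
    then show ?thesis using g'(3)[OF C(2)] by blast
  qed
  ultimately obtain t where t: "t \<in> span B" "\<And>w. w \<in> span B \<Longrightarrow> ?h (component v d - t) w = 0"
    using orthogonal_projection_span[OF independent_imp_finite[OF B(2)], of ?h "component v d"] sym by blast
  have Cv: "C (component v d) = v" unfolding C_def by (rule coord_field_of_component[OF v d])
  have "C t \<in> sub_tangent M N p" using t(1) by (simp add: W span_B C_def)
  moreover have "v - C t \<in> sub_normal M N g p"
    using t(2) V v C(2) unfolding sub_normal_def W span_B
    by (auto simp: linear_diff[OF C(1)] Cv subspace_diff simp flip: C_def)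
  ultimately have "C t \<in> sub_tangent M N p \<and> (\<exists>w\<in>sub_normal M N g p. v = C t + w)"
    by (metis add.commute diff_add_cancel)
  \<comment> \<open>The difference of two solutions is both tangent and normal, so its length is
    zero.\<close>
  moreover have "t1 = t2"
    if t1: "t1 \<in> sub_tangent M N p" "w1 \<in> sub_normal M N g p" "v = t1 + w1"
      and t2: "t2 \<in> sub_tangent M N p" "w2 \<in> sub_normal M N g p" "v = t2 + w2" for t1 t2 w1 w2
  proof (rule ccontr)
    assume ne: "t1 \<noteq> t2"
    have t12: "t1 - t2 \<in> sub_tangent M N p" using subspace_diff[OF W_subspace t1(1) t2(1)] .
    have eq: "t1 - t2 = w2 - w1" using t1(3) t2(3) by (simp add: algebra_simps)
    have w: "w1 \<in> ?V" "w2 \<in> ?V" "g p w1 (t1 - t2) = 0" "g p w2 (t1 - t2) = 0"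
      using t1(2) t2(2) t12 by (auto simp: sub_normal_def)
    have t12V: "t1 - t2 \<in> ?V" using t12 W_V by blast
    have "g p (t1 - t2) (w2 - w1) = g p (t1 - t2) w2 - g p (t1 - t2) w1"
      by (rule lin_on_simps(3)[OF g'(1)[OF t12V] V w(2,1)])
    also have "\<dots> = 0" using w g'(2)[OF t12V w(1)] g'(2)[OF t12V w(2)] by simp
    finally have "g p (t1 - t2) (t1 - t2) = 0" by (simp flip: eq)
    then show False using g'(3)[OF t12V] ne by simp
  qed
  ultimately show ?thesis by blast
qed

lemma inner_tangential_part:
  fixes N :: "('a, 'e::euclidean_space) manifold"
  assumes M: "smooth_manifold m M" and N: "smooth_manifold n N" and i: "smooth_map M N (\<lambda>p. p)"
    and g: "riemannian_metric N g" and p: "p \<in> carrier M" "p \<in> carrier N"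
    and v: "\<phi> p v \<in> tangent_space N p" and u: "u \<in> sub_tangent M N p" "u \<in> tangent_space N p"
  shows "g p u (tangential_part M N \<phi> g p v) = g p u (\<phi> p v)"
proof -
  let ?t = "tangential_part M N \<phi> g p v"
  have t: "?t \<in> sub_tangent M N p \<and> (\<exists>w\<in>sub_normal M N g p. \<phi> p v = ?t + w)"
    unfolding tangential_part_def by (rule theI'[OF orthogonal_decomposition[OF M N i g p v]])
  then obtain w where w: "w \<in> sub_normal M N g p" "\<phi> p v = ?t + w" by blast
  note V = tangent_space_subspace[OF N, of p]
  note g' = riemannian_metricD[OF g p(2)]
  have wV: "w \<in> tangent_space N p" "g p w u = 0" using w(1) u(1) by (auto simp: sub_normal_def)
  have "?t = \<phi> p v - w" using w(2) by simp
  then have "g p u ?t = g p u (\<phi> p v) - g p u w"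
    using lin_on_simps(3)[OF g'(1)[OF u(2)] V v wV(1)] by simp
  then show ?thesis using wV g'(2)[OF u(2) wV(1)] by simp
qed

section \<open>Pullback of coefficient forms along the inclusion\<close>

definition pullback_form ::
    "('a, 'u::real_normed_vector) chart \<Rightarrow> ('a, 'v::real_normed_vector) chart \<Rightarrow>
     ('v \<Rightarrow> 'v \<Rightarrow> 'v \<Rightarrow> real) \<Rightarrow> 'u \<Rightarrow> 'u \<Rightarrow> 'u \<Rightarrow> real" where
  "pullback_form c d h x u v = h (local_rep c d (\<lambda>p. p) x)
     (chart_jacobian c d (chart_inv c x) u) (chart_jacobian c d (chart_inv c x) v)"

lemma pullback_form_bilinear:
  assumes "compatible c d" "q \<in> fst c" "q \<in> fst d" "bilinear (h (snd d q))"
  shows "bilinear (pullback_form c d h (snd c q))"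
proof -
  have J: "linear (chart_jacobian c d q)" using assms by (simp add: chart_jacobian_linear)
  have "linear (h (snd d q) a)" "linear (\<lambda>v. h (snd d q) v a)" for a
    using assms(4) by (auto simp: bilinear_def)
  from linear_compose[OF J this(1)] linear_compose[OF J this(2)]
  have "linear (\<lambda>v. h (snd d q) a (chart_jacobian c d q v))" "linear (\<lambda>v. h (snd d q) (chart_jacobian c d q v) a)" for a
    by (simp_all add: comp_def)
  moreover have "chart_inv c (snd c q) = q" using assms by (simp add: compatible_def chart_inv_snd)
  ultimately show ?thesis
    unfolding bilinear_def pullback_form_def local_rep_ident[OF assms(1,2)] by simp
qed

context
  fixes c :: "('a, 'u::real_normed_vector) chart" and d :: "('a, 'e::euclidean_space) chart"
    and h :: "'e \<Rightarrow> 'e \<Rightarrow> 'e \<Rightarrow> real"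
  assumes cd: "compatible c d" and d_open: "open (snd d ` fst d)"
    and h_bil: "\<And>y. y \<in> snd d ` fst d \<Longrightarrow> bilinear (h y)"
    and h_smooth: "\<And>u v. smooth_on (snd d ` fst d) (\<lambda>y. h y u v)"
begin

lemma coefficient_along_inclusion_smooth:
  "smooth_on (snd c ` (fst c \<inter> fst d)) (\<lambda>x. h (local_rep c d (\<lambda>p. p) x) u v)"
  using cd by (intro smooth_on_compose[OF _ d_open _ h_smooth]) (auto simp: compatible_def local_rep_ident)

lemma pullback_form_smooth:
  "smooth_on (snd c ` (fst c \<inter> fst d)) (\<lambda>x. pullback_form c d h x u v)"
  unfolding pullback_form_def
proof (rule smooth_on_bilinear_form[OF _ _ coefficient_along_inclusion_smooth])
  show "bilinear (h (local_rep c d (\<lambda>p. p) x))" if "x \<in> snd c ` (fst c \<inter> fst d)" for x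
    using that cd by (auto simp: local_rep_ident intro!: h_bil)
qed (use cd chart_jacobian_smooth[OF cd] in \<open>auto simp: compatible_def\<close>)

text \<open>Naturality of the exterior derivative. Differentiating the Jacobians adds six terms with
  second derivatives of the inclusion; they cancel because second derivatives are symmetric and the
  form is skew.\<close>

lemma coord_ext_deriv_pullback_form:
  assumes q: "q \<in> fst c" "q \<in> fst d" and skew: "\<And>u v. h (snd d q) u v = - h (snd d q) v u"
  shows "coord_ext_deriv (pullback_form c d h) (snd c q) u v w
    = coord_ext_deriv h (snd d q) (chart_jacobian c d q u) (chart_jacobian c d q v) (chart_jacobian c d q w)"
proof -
  let ?S = "snd c ` (fst c \<inter> fst d)" and ?F = "local_rep c d (\<lambda>p. p)" and ?J = "chart_jacobian c d q"
  define G where "G u x = chart_jacobian c d (chart_inv c x) u" for u x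
  define D2 where "D2 u = frechet_derivative (G u) (at (snd c q))" for u
  have S: "open ?S" "snd c q \<in> ?S" using cd q by (auto simp: compatible_def)
  have F: "smooth_on ?S ?F" using cd by (simp add: compatible_def)
  have inv: "chart_inv c (snd c q) = q" using cd q by (simp add: compatible_def chart_inv_snd)
  have D2: "(G u has_derivative D2 u) (at (snd c q))" for u
    using smooth_on_differentiable[OF chart_jacobian_smooth[OF cd] S(2)]
    unfolding D2_def G_def by (simp flip: frechet_derivative_works)
  \<comment> \<open>The Jacobian is the first derivative of the inclusion at every point of the
    overlap, so \<open>D2\<close> is its second derivative.\<close>
  have "D2 u = frechet_derivative (\<lambda>x. frechet_derivative ?F (at x) u) (at (snd c q))" for u
    unfolding D2_def
    by (rule frechet_derivative_cong_open[OF S])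
       (use cd in \<open>auto simp: G_def chart_jacobian_def compatible_def chart_inv_snd\<close>)
  then have D2_sym: "D2 u w = D2 w u" for u w
    using second_derivative_symmetric[OF S F, of u w] by simp
  have D: "frechet_derivative (\<lambda>x. pullback_form c d h x u v) (at (snd c q)) w
      = frechet_derivative (\<lambda>y. h y (?J u) (?J v)) (at (snd d q)) (?J w)
        + h (snd d q) (D2 u w) (?J v) + h (snd d q) (?J u) (D2 v w)" for u v w
  proof -
    have "((\<lambda>x. h (?F x) (G u x) (G v x)) has_derivative (\<lambda>w.
        frechet_derivative (\<lambda>x. h (?F x) (G u (snd c q)) (G v (snd c q))) (at (snd c q)) w
        + h (?F (snd c q)) (D2 u w) (G v (snd c q)) + h (?F (snd c q)) (G u (snd c q)) (D2 v w))) (at (snd c q))"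
    proof (rule bilinear_field_has_derivative[OF frame_Basis S _ _ D2 D2])
      show "bilinear (h (?F x))" if "x \<in> ?S" for x
        using that cd by (auto simp: local_rep_ident intro!: h_bil)
      show "(\<lambda>x. h (?F x) u v) differentiable (at (snd c q))" for u v
        by (rule smooth_on_differentiable[OF coefficient_along_inclusion_smooth S(2)])
    qed
    then have 1: "frechet_derivative (\<lambda>x. pullback_form c d h x u v) (at (snd c q)) w
      = frechet_derivative (\<lambda>x. h (?F x) (?J u) (?J v)) (at (snd c q)) w
        + h (snd d q) (D2 u w) (?J v) + h (snd d q) (?J u) (D2 v w)"
      unfolding pullback_form_def G_def by (simp add: frechet_derivative_eq inv local_rep_ident[OF cd q(1)])
    have hd: "((\<lambda>y. h y (?J u) (?J v)) has_derivative frechet_derivative (\<lambda>y. h y (?J u) (?J v)) (at (?F (snd c q))))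
        (at (?F (snd c q)))"
      using smooth_on_differentiable[OF h_smooth] q by (simp add: local_rep_ident[OF cd] flip: frechet_derivative_works)
    have 2: "((\<lambda>x. h (?F x) (?J u) (?J v)) has_derivative
        (\<lambda>w. frechet_derivative (\<lambda>y. h y (?J u) (?J v)) (at (?F (snd c q))) (?J w))) (at (snd c q))"
      by (rule has_derivative_compose[OF local_rep_has_derivative[OF cd q] hd])
    show ?thesis unfolding 1 frechet_derivative_eq[OF 2] local_rep_ident[OF cd q(1)] ..
  qed
  show ?thesis
    unfolding coord_ext_deriv_def D D2_sym[of w u] D2_sym[of w v] D2_sym[of v u]
    \<comment> \<open>Two pairs of second-derivative terms cancel by symmetry alone. The third pair
      has the second derivative in different slots of \<open>h\<close>, with the same sign, and
      cancels by skewness.\<close>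
    using skew[of "?J v" "D2 u w"] by simp
qed

end

section \<open>The slant form\<close>

text \<open>The hypotheses ask for the coordinate formula of the differential instead of tangency of
  \<open>u\<close> and \<open>v\<close>. Thus Lie brackets on \<open>M\<close> are covered, for
  which the formula holds in the selected chart.\<close>

lemma slant_form_eq:
  fixes N :: "('a, 'e::euclidean_space) manifold"
  assumes M: "smooth_manifold m M" and N: "smooth_manifold n N" and i: "smooth_map M N (\<lambda>p. p)"
    and g: "riemannian_metric N g" and \<phi>: "endo_field N \<phi>" and p: "p \<in> carrier M" "p \<in> carrier N"
    and d: "d \<in> charts_at N p" and c: "c \<in> charts_at M p"
    and u: "differential M N (\<lambda>p. p) p u = coord_field N d (chart_jacobian c d p (component u c)) p"
    and v: "differential M N (\<lambda>p. p) p v = coord_field N d (chart_jacobian c d p (component v c)) p"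
  shows "slant_form M N \<phi> g p u v
    = pullback_form c d (local_form N d (\<lambda>q u v. g q u (\<phi> q v))) (snd c p) (component u c) (component v c)"
proof -
  let ?u = "coord_field N d (chart_jacobian c d p (component u c)) p"
  let ?v = "coord_field N d (chart_jacobian c d p (component v c)) p"
  have T: "?u \<in> tangent_space N p" "?v \<in> tangent_space N p"
    using coord_field_in_tangent_space[OF N d] by auto
  have "?u \<in> sub_tangent M N p" unfolding sub_tangent_eq_range[OF M N i p(1) d c] by blast
  moreover have "\<phi> p ?v \<in> tangent_space N p" using \<phi> p(2) T(2) by (auto simp: endo_field_def)
  ultimately have "slant_form M N \<phi> g p u v = g p ?u (\<phi> p ?v)"
    unfolding slant_form_def u v using inner_tangential_part[OF M N i g p] T(1) by blast
  moreover have "compatible c d" using compatible_submanifold[OF M N i] charts_atD[OF c] charts_atD[OF d] by blast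
  moreover have "chart_inv c (snd c p) = p" "chart_inv d (snd d p) = p"
    by (rule chart_inv_charts_atD(1)[OF M c] chart_inv_charts_atD(1)[OF N d])+
  ultimately show ?thesis
    using charts_atD[OF c] by (simp add: pullback_form_def local_form_def local_rep_ident)
qed

lemma linear_imp_lin_on: "linear f \<Longrightarrow> lin_on V f"
  by (simp add: lin_on_def linear_add linear_cmul)

text \<open>Smoothness of the slant form is not visible from its pointwise definition by projection.
  Like closedness, it comes from the local identity with a pullback, which the two proofs
  share.\<close>

lemma cosymplectic_slant_form:
  fixes N :: "('a, 'e::euclidean_space) manifold" and M :: "('a, 'f::real_normed_vector) manifold"
  assumes cos: "cosymplectic n N \<phi> \<xi> \<eta> g" and sub: "submanifold M N"
  shows "two_form M (slant_form M N \<phi> g)" "closed_form M (slant_form M N \<phi> g)"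
proof -
  define \<Phi> where "\<Phi> = (\<lambda>q u v. g q u (\<phi> q v))"
  have acm: "almost_contact_metric n N \<phi> \<xi> \<eta> g" using cos by (simp add: cosymplectic_def)
  obtain D where D: "levi_civita N g D"
    "\<And>X Y p. vector_field N X \<Longrightarrow> vector_field N Y \<Longrightarrow> p \<in> carrier N \<Longrightarrow> cov_deriv_endo D \<phi> X Y p = 0"
    using cos by (auto simp: cosymplectic_def)
  have N: "smooth_manifold (2 * n + 1) N" and \<phi>: "endo_field N \<phi>" and g: "riemannian_metric N g"
    using acm by (auto simp: almost_contact_metric_def)
  obtain m where M: "smooth_manifold m M" using sub by (auto simp: submanifold_def)
  have i: "smooth_map M N (\<lambda>p. p)" and MN: "carrier M \<subseteq> carrier N"
    and inj: "\<And>p. p \<in> carrier M \<Longrightarrow> inj_on (differential M N (\<lambda>p. p) p) (tangent_space M p)"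
    using sub by (auto simp: submanifold_def)
  have g': "bilinear_field N g" using g by (simp add: riemannian_metric_def)
  have \<Phi>: "bilinear_field N \<Phi>"
    unfolding \<Phi>_def by (rule bilinear_field_compose_endo[OF N \<phi> g'])
  have skew: "\<Phi> p u v = - \<Phi> p v u"
    if "p \<in> carrier N" "u \<in> tangent_space N p" "v \<in> tangent_space N p" for p u v
    unfolding \<Phi>_def
  proof (rule almost_contact_skew[where V = "tangent_space N p" and \<eta> = "\<eta> p" and \<xi> = "\<xi> p"])
    show "\<xi> p \<in> tangent_space N p"
      using acm that(1) by (simp add: almost_contact_metric_def vector_field_in_tangent_space)
    show "lin_on (tangent_space N p) (\<phi> p)" "\<phi> p ` tangent_space N p \<subseteq> tangent_space N p"
      using \<phi> that(1) by (auto simp: endo_field_def)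
    show "lin_on (tangent_space N p) (\<eta> p)"
      using acm that(1) by (simp add: almost_contact_metric_def one_form_def)
  qed (use acm that tangent_space_subspace[OF N] riemannian_metricD[OF g that(1)]
      in \<open>auto simp: almost_contact_metric_def\<close>)
  have closed: "closed_form N \<Phi>"
    unfolding closed_form_def \<Phi>_def
    using parallel_two_form_closed[OF N \<phi> g' D] skew[unfolded \<Phi>_def] by blast
  \<comment> \<open>Torsion-freeness makes the bracket a difference of covariant derivatives, which
    are vector fields; this spares the transformation rule for brackets.\<close>
  have lie: "lie_bracket N X Y p \<in> tangent_space N p"
    if "vector_field N X" "vector_field N Y" "p \<in> carrier N" for X Y p
    using levi_civitaD(1,2)[OF D(1)] that vector_field_in_tangent_space
      subspace_diff[OF tangent_space_subspace[OF N]] by metis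
  let ?K = "\<lambda>d. local_form N d \<Phi>"
  have K: "bilinear (?K d y)" if "d \<in> atlas N" "y \<in> snd d ` fst d" for d y
    by (rule local_form_bilinear[OF N that(1) \<Phi> that(2)])
  have K_smooth: "smooth_on (snd d ` fst d) (\<lambda>y. ?K d y u v)" if "d \<in> atlas N" for d u v
    by (rule local_form_smooth[OF \<Phi> that])
  have K_skew: "?K d (snd d p) u v = - ?K d (snd d p) v u" if d: "d \<in> charts_at N p" for d p u v
  proof -
    note p = chart_inv_charts_atD[OF N d]
    show ?thesis
      unfolding local_form_def p(1) by (intro skew p(2) coord_field_in_tangent_space[OF N d])
  qed
  have cd: "compatible c d" if "c \<in> atlas M" "d \<in> atlas N" for c d
    using compatible_submanifold[OF M N i that] .
  note d_open = chart_properties(2)[OF N]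
  have \<Omega>: "slant_form M N \<phi> g p u v = pullback_form c d (?K d) (snd c p) (component u c) (component v c)"
    if "p \<in> carrier M" "c \<in> charts_at M p" "d \<in> charts_at N p" "u \<in> tangent_space M p" "v \<in> tangent_space M p"
    for p c d u v
    unfolding \<Phi>_def
    using that MN by (intro slant_form_eq[OF M N i g \<phi>] differential_inclusion[OF M N i]) auto
  show "two_form M (slant_form M N \<phi> g)"
    unfolding two_form_def bilinear_field_def
  proof (intro conjI ballI allI)
    fix p u assume p: "p \<in> carrier M" and u: "u \<in> tangent_space M p"
    obtain c d where c: "c \<in> charts_at M p" and d: "d \<in> charts_at N p"
      using some_chart_at[OF M p] some_chart_at[OF N, of p] p MN by blast
    let ?P = "pullback_form c d (?K d) (snd c p)"
    have "bilinear ?P"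
      using charts_atD[OF c] charts_atD[OF d] by (intro pullback_form_bilinear cd K) auto
    then have "linear (?P (component u c))" "linear (\<lambda>v. ?P v (component u c))" by (auto simp: bilinear_def)
    note this[THEN linear_compose[OF component_linear[of c]]]
    then have lin: "linear (\<lambda>v. ?P (component u c) (component v c))" "linear (\<lambda>v. ?P (component v c) (component u c))"
      by (simp_all add: comp_def)
    note eq = \<Omega>[OF p c d]
    have V: "a *\<^sub>R v + b *\<^sub>R w \<in> tangent_space M p"
      if "v \<in> tangent_space M p" "w \<in> tangent_space M p" for a b v w
      using that tangent_space_subspace[OF M] by (intro subspace_add subspace_scale)
    show "lin_on (tangent_space M p) (\<lambda>v. slant_form M N \<phi> g p u v)"
      using linear_imp_lin_on[OF lin(1)] unfolding lin_on_def
      by (simp add: eq u V del: component_simps)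
    show "lin_on (tangent_space M p) (\<lambda>v. slant_form M N \<phi> g p v u)"
      using linear_imp_lin_on[OF lin(2)] unfolding lin_on_def
      by (simp add: eq u V del: component_simps)
    show "slant_form M N \<phi> g p u u = 0"
    proof -
      have "?P (component u c) (component u c) = - ?P (component u c) (component u c)"
        unfolding pullback_form_def local_rep_ident[OF cd[OF charts_atD(1)[OF c] charts_atD(1)[OF d]] charts_atD(2)[OF c]]
        by (rule K_skew[OF d])
      then show ?thesis using eq[OF u u] by simp
    qed
  next
    fix c and u v :: 'f assume c: "c \<in> atlas M"
    show "smooth_on (snd c ` fst c) (\<lambda>x. slant_form M N \<phi> g (chart_inv c x)
      (coord_field M c u (chart_inv c x)) (coord_field M c v (chart_inv c x)))"
    proof (rule smooth_on_local)
      fix x assume "x \<in> snd c ` fst c"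
      then obtain q where q: "q \<in> fst c" "x = snd c q" by blast
      have "q \<in> carrier N" using q(1) chart_properties(3)[OF M c] MN by blast
      then obtain d where d: "d \<in> charts_at N q" using some_chart_at[OF N] by blast
      have dA: "d \<in> atlas N" and qd: "q \<in> fst d" using charts_atD[OF d] by auto
      let ?U = "snd c ` (fst c \<inter> fst d)"
      have U: "open ?U" using cd[OF c dA] by (simp add: compatible_def)
      have "smooth_on ?U (\<lambda>x. pullback_form c d (?K d) x u v)"
        by (rule pullback_form_smooth[OF cd[OF c dA] d_open[OF dA] K[OF dA] K_smooth[OF dA]])
      then have "smooth_on ?U (\<lambda>x. slant_form M N \<phi> g (chart_inv c x)
        (coord_field M c u (chart_inv c x)) (coord_field M c v (chart_inv c x)))"
      proof (rule smooth_on_cong[OF U, rotated])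
        fix x assume "x \<in> ?U"
        then obtain q where q: "q \<in> fst c" "q \<in> fst d" "x = snd c q" by blast
        then have "c \<in> charts_at M q" "d \<in> charts_at N q"
          using c dA by (simp_all add: charts_at_def)
        with chart_inv_charts_atD[OF M this(1)] show "pullback_form c d (?K d) x u v = slant_form M N \<phi> g (chart_inv c x)
          (coord_field M c u (chart_inv c x)) (coord_field M c v (chart_inv c x))"
          using \<Omega>[of q c d "coord_field M c u q" "coord_field M c v q"] q(3)
          by (simp add: coord_field_in_tangent_space[OF M] component_coord_field_self[OF M])
      qed
      then show "\<exists>U. open U \<and> x \<in> U \<and> smooth_on U (\<lambda>x. slant_form M N \<phi> g (chart_inv c x)
        (coord_field M c u (chart_inv c x)) (coord_field M c v (chart_inv c x)))"
        using U q qd by blast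
    qed
  qed
  show "closed_form M (slant_form M N \<phi> g)"
    unfolding closed_form_def
  proof (intro allI impI ballI)
    fix X Y Z p
    assume XYZ: "vector_field M X" "vector_field M Y" "vector_field M Z" and p: "p \<in> carrier M"
    \<comment> \<open>On \<open>M\<close>, \<open>c\<close> is the chart that both
      \<open>dir_deriv\<close> and \<open>differential\<close> select at \<open>p\<close>; on
      \<open>N\<close>, \<open>d\<close> is the one selected by \<open>dir_deriv\<close>. The
      coordinate formulas for the exterior derivatives are stated in these charts.\<close>
    define c where "c = (SOME c. c \<in> charts_at M p)"
    define d where "d = (SOME d. d \<in> charts_at N p)"
    have pN: "p \<in> carrier N" using p MN by blast
    have c: "c \<in> charts_at M p" unfolding c_def by (rule some_chart_at[OF M p])
    have d: "d \<in> charts_at N p" unfolding d_def by (rule some_chart_at[OF N pN])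
    have cA: "c \<in> atlas M" and pc: "p \<in> fst c" using charts_atD[OF c] by auto
    have dA: "d \<in> atlas N" and pd: "p \<in> fst d" using charts_atD[OF d] by auto
    note comp = cd[OF cA dA]
    \<comment> \<open>The immersion property in coordinates. It embeds the model space of
      \<open>M\<close> in that of \<open>N\<close> and so yields the frame with which forms on
      \<open>M\<close> are differentiated.\<close>
    have "inj (chart_jacobian c d p)"
    proof (rule injI)
      fix u v assume uv: "chart_jacobian c d p u = chart_jacobian c d p v"
      have "differential M N (\<lambda>p. p) p (coord_field M c u p) = differential M N (\<lambda>p. p) p (coord_field M c v p)"
        using uv by (simp add: differential_inclusion[OF M N i p d c] coord_field_in_tangent_space[OF M c]
            component_coord_field_self[OF M c])
      then have "coord_field M c u p = coord_field M c v p"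
        using inj[OF p] coord_field_in_tangent_space[OF M c] by (auto dest: inj_onD)
      then show "u = v" using component_coord_field_self[OF M c] by metis
    qed
    then obtain b where fr: "frame (Basis :: 'e set) b (\<lambda>e v. chart_jacobian c d p v \<bullet> e)"
      using frame_of_embedding[OF chart_jacobian_bounded_linear[OF comp pc pd]] by blast
    let ?U = "snd c ` (fst c \<inter> fst d)" and ?P = "pullback_form c d (?K d)"
    have U: "open ?U" "snd c p \<in> ?U" "?U \<subseteq> snd c ` fst c"
      using comp pc pd by (auto simp: compatible_def)
    have "ext_deriv M (slant_form M N \<phi> g) X Y Z p
      = coord_ext_deriv ?P (snd c p) (component (X p) c) (component (Y p) c) (component (Z p) c)"
    proof (rule ext_deriv_in_chart[OF fr M p c_def U _ _ _ _ _ XYZ])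
      fix x u v assume "x \<in> ?U" and uv: "u \<in> tangent_space M (chart_inv c x)" "v \<in> tangent_space M (chart_inv c x)"
      then obtain q where q: "q \<in> fst c" "q \<in> fst d" "x = snd c q" by blast
      then have "c \<in> charts_at M q" "d \<in> charts_at N q"
        using cA dA by (simp_all add: charts_at_def)
      with chart_inv_charts_atD[OF M this(1)] show "slant_form M N \<phi> g (chart_inv c x) u v = ?P x (component u c) (component v c)"
        using \<Omega>[of q c d u v] uv q(3) by simp
    next
      fix X Y Z assume "vector_field M X" "vector_field M Y" "vector_field M Z"
      show "slant_form M N \<phi> g p (lie_bracket M X Y p) (Z p)
        = ?P (snd c p) (component (lie_bracket M X Y p) c) (component (Z p) c)"
        unfolding \<Phi>_def
        by (intro slant_form_eq[OF M N i g \<phi> p pN d c] differential_inclusion_some_chart[OF M N i p d c_def])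
    next
      fix x assume "x \<in> ?U"
      then show "bilinear (?P x)" using K[OF dA] by (auto intro!: pullback_form_bilinear[OF comp])
    next
      fix u v
      show "(\<lambda>x. ?P x u v) differentiable (at (snd c p))"
        by (rule smooth_on_differentiable[OF pullback_form_smooth[OF comp d_open[OF dA] K[OF dA] K_smooth[OF dA]] U(2)])
      show "?P (snd c p) u v = - ?P (snd c p) v u"
        unfolding pullback_form_def local_rep_ident[OF comp pc] by (rule K_skew[OF d])
    qed
    also have "\<dots> = coord_ext_deriv (?K d) (snd d p) (chart_jacobian c d p (component (X p) c))
        (chart_jacobian c d p (component (Y p) c)) (chart_jacobian c d p (component (Z p) c))"
      by (rule coord_ext_deriv_pullback_form[OF comp d_open[OF dA] K[OF dA] K_smooth[OF dA] pc pd K_skew[OF d]])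
    also have "\<dots> = 0"
      by (rule closed_form_coord_ext_deriv[OF N \<Phi> skew closed lie pN d_def])
    finally show "ext_deriv M (slant_form M N \<phi> g) X Y Z p = 0" .
  qed
qed

theorem theorem5p2:
  fixes n :: nat
    and N :: "('a, 'e::euclidean_space) manifold"
    and M :: "('a, 'f::real_normed_vector) manifold"
    and \<phi> :: "'a \<Rightarrow> ('a, 'e) tvec \<Rightarrow> ('a, 'e) tvec"
    and \<xi> :: "'a \<Rightarrow> ('a, 'e) tvec"
    and \<eta> :: "'a \<Rightarrow> ('a, 'e) tvec \<Rightarrow> real"
    and g :: "'a \<Rightarrow> ('a, 'e) tvec \<Rightarrow> ('a, 'e) tvec \<Rightarrow> real"
  assumes "cosymplectic n N \<phi> \<xi> \<eta> g"
    and "proper_pointwise_slant M N \<phi> \<xi> g"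
  shows "two_form M (slant_form M N \<phi> g) \<and> closed_form M (slant_form M N \<phi> g)"
proof -
  have "submanifold M N" using assms(2) by (simp add: proper_pointwise_slant_def)
  from cosymplectic_slant_form[OF assms(1) this] show ?thesis by blast
qed

end
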